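(* Let $P$ be a finite $p$-group having a normal cyclic subgroup of index $p$. Then the $\mathcal{O}$-algebra $\mathcal{O}Pe(\chi)$ is symmetric for any $\chi\in\mathrm{Irr}_K(P)$.
   Context: Let $p$ be a prime and $\mathcal{O}$ a complete discrete valuation ring with residue field $k$ of characteristic $p$ and quotient field $K$ of characteristic zero; $K$ and $k$ are assumed to be splitting fields for all finite groups under consideration. $\mathrm{Irr}_K(P)$ is the set of irreducible $K$-valued characters of $P$. For $\chi\in\mathrm{Irr}_K(P)$, $e(\chi)=\frac{\chi(1)}{|P|}\sum_{x\in P}\chi(x^{-1})x$ is the primitive idempotent of $Z(KP)$ corresponding to $\chi$, and $\mathcal{O}Pe(\chi)\subseteq KP$ is the image of $\mathcal{O}P$ under multiplication by $e(\chi)$, an $\mathcal{O}$-algebra with unit $e(\chi)$. An $\mathcal{O}$-algebra $A$ is symmetric if $A$ is finitely generated projective as an $\mathcal{O}$-module and $A\cong\mathrm{Hom}_{\mathcal{O}}(A,\mathcal{O})$ as $A$-$A$-bimodules. *)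

theory Defs
  imports
    "HOL-Algebra.Elementary_Groups"
    "Jordan_Normal_Form.VS_Connect"
begin

section \<open>Complete discrete valuation rings\<close>

text \<open>The quotient field \<open>K\<close> is a type \<open>'a\<close> and \<open>\<O>\<close> is a subset of it. A discrete valuation
  is a surjective homomorphism from the multiplicative group of \<open>K\<close> to the integers; its value at
  \<open>0\<close> (mathematically infinite) is never used.\<close>

definition discrete_valuation :: "('a::field \<Rightarrow> int) \<Rightarrow> bool" where
  "discrete_valuation v \<longleftrightarrow>
     (\<forall>x y. x \<noteq> 0 \<longrightarrow> y \<noteq> 0 \<longrightarrow> v (x * y) = v x + v y) \<and>
     (\<forall>x y. x \<noteq> 0 \<longrightarrow> y \<noteq> 0 \<longrightarrow> x + y \<noteq> 0 \<longrightarrow> min (v x) (v y) \<le> v (x + y)) \<and>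
     (\<forall>n. \<exists>x. x \<noteq> 0 \<and> v x = n)"

definition valuation_ring :: "('a::field \<Rightarrow> int) \<Rightarrow> 'a set" where
  "valuation_ring v = {x. x = 0 \<or> 0 \<le> v x}"

definition val_close :: "('a::field \<Rightarrow> int) \<Rightarrow> nat \<Rightarrow> 'a \<Rightarrow> 'a \<Rightarrow> bool" where
  "val_close v N x y \<longleftrightarrow> x = y \<or> int N \<le> v (x - y)"

text \<open>\<open>val_close v N x y\<close> says that \<open>x - y\<close> lies in the \<open>N\<close>-th power of the maximal ideal.
  That \<open>K\<close> is the quotient field of \<open>\<O>\<close> is automatic, as \<open>\<O>\<close> is the ring of a valuation on all
  of \<open>K\<close>.\<close>

definition complete_dvr :: "'a::field set \<Rightarrow> bool" where
  "complete_dvr \<O> \<longleftrightarrow>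
     (\<exists>v. discrete_valuation v \<and> \<O> = valuation_ring v \<and>
       (\<forall>s :: nat \<Rightarrow> 'a. range s \<subseteq> \<O> \<longrightarrow>
          (\<forall>N. \<exists>M. \<forall>i\<ge>M. \<forall>j\<ge>M. val_close v N (s i) (s j)) \<longrightarrow>
          (\<exists>l\<in>\<O>. \<forall>N. \<exists>M. \<forall>i\<ge>M. val_close v N (s i) l)))"

abbreviation coeff_ring :: "'a::field set \<Rightarrow> 'a ring" where
  "coeff_ring S \<equiv> class_ring\<lparr>carrier := S\<rparr>"

text \<open>The residue field is a type \<open>'k\<close>, given with the canonical surjection from \<open>\<O>\<close>, whose kernel
  is the maximal ideal, i.e. the set of non-units of \<open>\<O>\<close>.\<close>

definition residue_map :: "'a::field set \<Rightarrow> ('a \<Rightarrow> 'k::field) \<Rightarrow> bool" where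
  "residue_map \<O> \<pi> \<longleftrightarrow>
     \<pi> \<in> Ring.ring_hom (coeff_ring \<O>) class_ring \<and> \<pi> ` \<O> = UNIV \<and>
     (\<forall>x\<in>\<O>. \<pi> x = 0 \<longleftrightarrow> x \<notin> Units (coeff_ring \<O>))"


section \<open>Matrix representations, splitting fields and characters\<close>

definition representation ::
  "('g, 'm) monoid_scheme \<Rightarrow> nat \<Rightarrow> ('g \<Rightarrow> 'a::field mat) \<Rightarrow> bool" where
  "representation G n \<rho> \<longleftrightarrow>
     \<rho> \<in> hom G (ring_mat TYPE('a) n ()) \<and> \<rho> \<one>\<^bsub>G\<^esub> = 1\<^sub>m n"

definition irreducible_representation ::
  "('g, 'm) monoid_scheme \<Rightarrow> nat \<Rightarrow> ('g \<Rightarrow> 'a::field mat) \<Rightarrow> bool" where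
  "irreducible_representation G n \<rho> \<longleftrightarrow>
     representation G n \<rho> \<and> 0 < n \<and>
     (\<forall>W. subspace class_ring W (module_vec TYPE('a) n) \<longrightarrow>
        (\<forall>x\<in>carrier G. \<forall>w\<in>W. \<rho> x *\<^sub>v w \<in> W) \<longrightarrow>
        W = {0\<^sub>v n} \<or> W = carrier_vec n)"

text \<open>A field \<open>F\<close> is a splitting field for \<open>G\<close> if every simple \<open>FG\<close>-module has endomorphism
  ring \<open>F\<close>.\<close>

definition splitting_field :: "'a::field itself \<Rightarrow> ('g, 'm) monoid_scheme \<Rightarrow> bool" where
  "splitting_field F G \<longleftrightarrow>
     (\<forall>n (\<rho> :: 'g \<Rightarrow> 'a mat). irreducible_representation G n \<rho> \<longrightarrow>
        (\<forall>M\<in>carrier_mat n n. (\<forall>x\<in>carrier G. M * \<rho> x = \<rho> x * M) \<longrightarrow>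
           (\<exists>c. M = c \<cdot>\<^sub>m 1\<^sub>m n)))"

definition mat_trace :: "'a::comm_monoid_add mat \<Rightarrow> 'a" where
  "mat_trace A = (\<Sum>i<dim_row A. A $$ (i, i))"

definition Irr :: "('g, 'm) monoid_scheme \<Rightarrow> ('g \<Rightarrow> 'a::field) set" where
  "Irr G = {\<chi>. \<exists>n \<rho>. irreducible_representation G n \<rho> \<and>
                     \<chi> = (\<lambda>x\<in>carrier G. mat_trace (\<rho> x))}"


section \<open>Group algebras and their character idempotents\<close>

text \<open>Elements of \<open>SG\<close>, for a subring \<open>S\<close> of \<open>K\<close>, are the functions \<open>G \<rightarrow> S\<close> extended by \<open>0\<close>
  outside of \<open>carrier G\<close>, with convolution as product (\<open>G\<close> is meant to be finite).\<close>

definition group_algebra ::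
  "'a::field set \<Rightarrow> ('g, 'm) monoid_scheme \<Rightarrow> ('a, 'g \<Rightarrow> 'a) module" where
  "group_algebra S G =
     \<lparr>carrier = {f. (\<forall>x\<in>carrier G. f x \<in> S) \<and> (\<forall>x. x \<notin> carrier G \<longrightarrow> f x = 0)},
      monoid.mult = (\<lambda>f h x. if x \<in> carrier G
                        then (\<Sum>y\<in>carrier G. f y * h (inv\<^bsub>G\<^esub> y \<otimes>\<^bsub>G\<^esub> x)) else 0),
      one = (\<lambda>x. if x = \<one>\<^bsub>G\<^esub> then 1 else 0),
      zero = (\<lambda>x. 0),
      add = (\<lambda>f h x. f x + h x),
      module.smult = (\<lambda>r f x. r * f x)\<rparr>"

definition char_idempotent ::
  "('g, 'm) monoid_scheme \<Rightarrow> ('g \<Rightarrow> 'a::field) \<Rightarrow> 'g \<Rightarrow> 'a" where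
  "char_idempotent G \<chi> =
     (\<lambda>x. if x \<in> carrier G
          then \<chi> \<one>\<^bsub>G\<^esub> / of_nat (Coset.order G) * \<chi> (inv\<^bsub>G\<^esub> x) else 0)"

definition char_component ::
  "'a::field set \<Rightarrow> ('g, 'm) monoid_scheme \<Rightarrow> ('g \<Rightarrow> 'a) \<Rightarrow> ('a, 'g \<Rightarrow> 'a) module" where
  "char_component S G \<chi> =
     (group_algebra UNIV G)
       \<lparr>carrier := (\<lambda>f. f \<otimes>\<^bsub>group_algebra UNIV G\<^esub> char_idempotent G \<chi>)
                      ` carrier (group_algebra S G),
        one := char_idempotent G \<chi>\<rparr>"


section \<open>Symmetric algebras\<close>

text \<open>Unlike the locale \<open>algebra\<close> of HOL-Algebra, the algebra need not be commutative.\<close>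

definition unital_algebra ::
  "('r, 'm) ring_scheme \<Rightarrow> ('r, 'b, 'n) module_scheme \<Rightarrow> bool" where
  "unital_algebra R A \<longleftrightarrow>
     Module.module R A \<and> ring A \<and>
     (\<forall>r\<in>carrier R. \<forall>x\<in>carrier A. \<forall>y\<in>carrier A.
        (r \<odot>\<^bsub>A\<^esub> x) \<otimes>\<^bsub>A\<^esub> y = r \<odot>\<^bsub>A\<^esub> (x \<otimes>\<^bsub>A\<^esub> y) \<and>
        x \<otimes>\<^bsub>A\<^esub> (r \<odot>\<^bsub>A\<^esub> y) = r \<odot>\<^bsub>A\<^esub> (x \<otimes>\<^bsub>A\<^esub> y))"

definition module_maps ::
  "('r, 'm) ring_scheme \<Rightarrow> ('r, 'b, 'n) module_scheme \<Rightarrow> ('r, 'c, 'o) module_scheme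
     \<Rightarrow> ('b \<Rightarrow> 'c) set" where
  "module_maps R M N =
     {f \<in> carrier M \<rightarrow>\<^sub>E carrier N.
        (\<forall>x\<in>carrier M. \<forall>y\<in>carrier M. f (x \<oplus>\<^bsub>M\<^esub> y) = f x \<oplus>\<^bsub>N\<^esub> f y) \<and>
        (\<forall>r\<in>carrier R. \<forall>x\<in>carrier M. f (r \<odot>\<^bsub>M\<^esub> x) = r \<odot>\<^bsub>N\<^esub> f x)}"

definition regular_module :: "('r, 'm) ring_scheme \<Rightarrow> ('r, 'r) module" where
  "regular_module R =
     \<lparr>carrier = carrier R, monoid.mult = monoid.mult R, one = one R, zero = zero R, add = add R,
      module.smult = monoid.mult R\<rparr>"

text \<open>The free module on a set \<open>I\<close>: finitely supported families. The ring operations required by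
  the record type of modules carry no meaning here.\<close>

definition free_module :: "('r, 'm) ring_scheme \<Rightarrow> 'i set \<Rightarrow> ('r, 'i \<Rightarrow> 'r) module" where
  "free_module R I =
     \<lparr>carrier = {f \<in> I \<rightarrow>\<^sub>E carrier R. finite {i \<in> I. f i \<noteq> \<zero>\<^bsub>R\<^esub>}},
      monoid.mult = undefined,
      one = undefined,
      zero = (\<lambda>i\<in>I. \<zero>\<^bsub>R\<^esub>),
      add = (\<lambda>f g. \<lambda>i\<in>I. f i \<oplus>\<^bsub>R\<^esub> g i),
      module.smult = (\<lambda>r f. \<lambda>i\<in>I. r \<otimes>\<^bsub>R\<^esub> f i)\<rparr>"

definition finitely_generated_module ::
  "('r, 'm) ring_scheme \<Rightarrow> ('r, 'b, 'n) module_scheme \<Rightarrow> bool" where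
  "finitely_generated_module R M \<longleftrightarrow>
     (\<exists>S. finite S \<and> S \<subseteq> carrier M \<and>
        (\<forall>x\<in>carrier M. \<exists>c\<in>S \<rightarrow> carrier R. x = (\<Oplus>\<^bsub>M\<^esub>s\<in>S. c s \<odot>\<^bsub>M\<^esub> s)))"

text \<open>Projective: a direct summand (split by \<open>\<iota>\<close> and \<open>\<sigma>\<close>) of a free module. Index sets
  in the type of the elements of \<open>M\<close> suffice, because \<open>M\<close> is a quotient of the free module on
  \<open>carrier M\<close>, and that map splits if \<open>M\<close> is projective.\<close>

definition projective_module ::
  "('r, 'm) ring_scheme \<Rightarrow> ('r, 'b, 'n) module_scheme \<Rightarrow> bool" where
  "projective_module R M \<longleftrightarrow>
     (\<exists>I :: 'b set. \<exists>\<iota>\<in>module_maps R M (free_module R I). \<exists>\<sigma>\<in>module_maps R (free_module R I) M.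
        \<forall>x\<in>carrier M. \<sigma> (\<iota> x) = x)"

abbreviation dual_module ::
  "('r, 'm) ring_scheme \<Rightarrow> ('r, 'b, 'n) module_scheme \<Rightarrow> ('b \<Rightarrow> 'r) set" where
  "dual_module R A \<equiv> module_maps R A (regular_module R)"

text \<open>The bimodule structure on the dual is \<open>(a \<cdot> \<phi> \<cdot> b)(z) = \<phi>(b z a)\<close>.\<close>

definition dual_bimodule_iso ::
  "('r, 'm) ring_scheme \<Rightarrow> ('r, 'b, 'n) module_scheme \<Rightarrow> ('b \<Rightarrow> 'b \<Rightarrow> 'r) \<Rightarrow> bool" where
  "dual_bimodule_iso R A \<Phi> \<longleftrightarrow>
     bij_betw \<Phi> (carrier A) (dual_module R A) \<and>
     (\<forall>x\<in>carrier A. \<forall>y\<in>carrier A.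
        \<Phi> (x \<oplus>\<^bsub>A\<^esub> y) = (\<lambda>z\<in>carrier A. \<Phi> x z \<oplus>\<^bsub>R\<^esub> \<Phi> y z)) \<and>
     (\<forall>a\<in>carrier A. \<forall>x\<in>carrier A. \<forall>b\<in>carrier A.
        \<Phi> (a \<otimes>\<^bsub>A\<^esub> x \<otimes>\<^bsub>A\<^esub> b) = (\<lambda>z\<in>carrier A. \<Phi> x (b \<otimes>\<^bsub>A\<^esub> z \<otimes>\<^bsub>A\<^esub> a)))"

definition symmetric_algebra ::
  "('r, 'm) ring_scheme \<Rightarrow> ('r, 'b, 'n) module_scheme \<Rightarrow> bool" where
  "symmetric_algebra R A \<longleftrightarrow>
     unital_algebra R A \<and> finitely_generated_module R A \<and> projective_module R A \<and>
     (\<exists>\<Phi>. dual_bimodule_iso R A \<Phi>)"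

end

theory Submission
  imports Defs "HOL-Number_Theory.Residues"
begin

text \<open>
  Write \<open>X x = x e(\<chi>)\<close> for the image of \<open>x \<in> P\<close> in \<open>A = \<O>Pe(\<chi>)\<close>. Over \<open>K\<close> this algebra is a
  matrix algebra, so a symmetrising form on \<open>A\<close> must be a multiple of the matrix trace, and the whole
  question is whether some rescaling \<open>s (X x) = c \<cdot> \<chi> x\<close> of the trace admits dual \<open>\<O>\<close>-bases inside \<open>A\<close>.
  An element \<open>\<Sum> f x \<cdot> X x\<close> is determined by the numbers \<open>\<Sum> f x \<cdot> \<chi> (w x)\<close>, \<open>w \<in> P\<close>; hence every identity
  in \<open>A\<close>, in particular the duality of two bases (\<open>symmetric_if_dual_family\<close>), is a linear relation
  between values of \<open>\<chi>\<close>. Schur's lemma takes the form of the functional equation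
  \<open>\<chi> 1 \<cdot> \<Sum>\<^sub>u \<chi> (x u y u\<inverse>) = |P| \<cdot> \<chi> x \<cdot> \<chi> y\<close>: a conjugation invariant sum of group elements acts as a scalar.

  Let \<open>C\<close> be the cyclic subgroup, \<open>g\<close> a generator, \<open>t \<notin> C\<close>, and \<open>t g t\<inverse> = g\<^sup>1\<^sup>+\<^sup>d\<close>. Then \<open>g\<close> and \<open>t\<close> generate \<open>P\<close>.

  First case: \<open>g ^ (d * d)\<close> acts trivially. Then \<open>g ^ d\<close>, the commutator of \<open>t\<close> and \<open>g\<close>, acts as a scalar,
  so any two elements of \<open>P\<close> commute up to a scalar. Therefore \<open>\<chi>\<close> vanishes outside the subgroup \<open>Z\<close> of
  elements that act as scalars, and \<open>A\<close> is a twisted group algebra of \<open>P/Z\<close>: coset representatives of \<open>Z\<close>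
  and their inverses are dual bases for \<open>c = 1 / \<chi> 1\<close> (\<open>symmetric_if_commute_up_to_scalar\<close>). As \<open>t ^ p\<close> lies
  in \<open>C\<close>, the order of \<open>g\<close> divides \<open>(1 + d) ^ p - 1\<close>, and lifting the exponent shows that this case
  covers every odd \<open>p\<close>, and \<open>p = 2\<close> unless \<open>d\<close> is twice an odd number and \<open>g ^ 4\<close> acts non-trivially.

  Second case: \<open>p = 2\<close>, as in dihedral, semidihedral and quaternion groups. Let \<open>y, y'\<close> be the images
  of \<open>g\<close> and \<open>t g t\<inverse>\<close>. Then \<open>y + y' = T\<close> is a scalar, and a power \<open>h\<^sup>r\<close> of \<open>h = g\<^sup>d\<close> with \<open>r\<close> even
  acts as \<open>-1\<close>. By a telescoping sum, \<open>v = h + h\<^sup>2 + \<dots> + h\<^sup>r\<^sup>-\<^sup>1\<close> satisfies \<open>(y - y') v = T\<close>. In terms of the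
  eigenvalues \<open>\<zeta>, \<zeta>'\<close> of \<open>y\<close> this says that \<open>T\<close> and \<open>\<zeta> - \<zeta>'\<close> differ by a unit, and dividing by \<open>T\<close>
  instead of \<open>\<zeta> - \<zeta>'\<close> defines the form over the field of values of \<open>\<chi>\<close>. It is the trace with
  \<open>c = 2 / (T \<chi>(1))\<close>, and \<open>1, g, t, g t\<close> has the dual basis \<open>-y'v, v, -t\<inverse>y'v, t\<inverse>v\<close>
  (\<open>symmetric_index_two\<close>).
\<close>

section \<open>Dual bases and symmetric algebras\<close>

text \<open>The last assumption says that \<open>B\<close> and \<open>D ` B\<close> are dual for the form \<open>s\<close>. The coordinates
  \<open>s (D b x)\<close> then make \<open>A\<close> a direct summand of the free module on \<open>B\<close>, and a linear form \<open>\<phi>\<close> is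
  represented by the element \<open>\<Sum> \<phi> b \<cdot> D b\<close>.\<close>

lemma symmetric_algebraI:
  fixes R :: "('r, 'm) ring_scheme" and A :: "('r, 'b, 'n) module_scheme"
  assumes alg: "unital_algebra R A"
    and s: "s \<in> module_maps R A (regular_module R)"
    and s_comm: "\<And>x y. x \<in> carrier A \<Longrightarrow> y \<in> carrier A \<Longrightarrow> s (x \<otimes>\<^bsub>A\<^esub> y) = s (y \<otimes>\<^bsub>A\<^esub> x)"
    and B: "finite B" "B \<subseteq> carrier A" and D: "D \<in> B \<rightarrow> carrier A"
    and dual: "\<And>x. x \<in> carrier A \<Longrightarrow> x = (\<Oplus>\<^bsub>A\<^esub>b\<in>B. s (D b \<otimes>\<^bsub>A\<^esub> x) \<odot>\<^bsub>A\<^esub> b)"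
  shows "symmetric_algebra R A"
proof -
  interpret A: ring A using alg by (simp add: unital_algebra_def)
  interpret M: Module.module R A using alg by (simp add: unital_algebra_def)
  have smult_mult: "(r \<odot>\<^bsub>A\<^esub> x) \<otimes>\<^bsub>A\<^esub> y = r \<odot>\<^bsub>A\<^esub> (x \<otimes>\<^bsub>A\<^esub> y)" "x \<otimes>\<^bsub>A\<^esub> (r \<odot>\<^bsub>A\<^esub> y) = r \<odot>\<^bsub>A\<^esub> (x \<otimes>\<^bsub>A\<^esub> y)"
    if "r \<in> carrier R" "x \<in> carrier A" "y \<in> carrier A" for r x y
    using alg that by (simp_all add: unital_algebra_def)
  have s_closed [simp]: "s x \<in> carrier R" if "x \<in> carrier A" for x
    using s that by (auto simp: module_maps_def regular_module_def)
  have s_add: "s (x \<oplus>\<^bsub>A\<^esub> y) = s x \<oplus>\<^bsub>R\<^esub> s y" if "x \<in> carrier A" "y \<in> carrier A" for x y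
    using s that by (auto simp: module_maps_def regular_module_def)
  have s_smult: "s (r \<odot>\<^bsub>A\<^esub> x) = r \<otimes>\<^bsub>R\<^esub> s x" if "r \<in> carrier R" "x \<in> carrier A" for r x
    using s that by (auto simp: module_maps_def regular_module_def)
  have Dc [simp]: "D b \<in> carrier A" if "b \<in> B" for b using D that by blast
  have Bc [simp]: "b \<in> carrier A" if "b \<in> B" for b using B that by blast
  note [simp] = B(1)
  have fg: "finitely_generated_module R A"
    unfolding finitely_generated_module_def
  proof (intro exI[of _ B] conjI ballI)
    fix x assume x: "x \<in> carrier A"
    show "\<exists>c\<in>B \<rightarrow> carrier R. x = (\<Oplus>\<^bsub>A\<^esub>b\<in>B. c b \<odot>\<^bsub>A\<^esub> b)"
      by (rule bexI[of _ "\<lambda>b. s (D b \<otimes>\<^bsub>A\<^esub> x)"]) (use dual[OF x] x in auto)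
  qed (use B in auto)
  define \<iota> where "\<iota> = (\<lambda>x\<in>carrier A. \<lambda>b\<in>B. s (D b \<otimes>\<^bsub>A\<^esub> x))"
  define \<sigma> where "\<sigma> = (\<lambda>f\<in>carrier (free_module R B). \<Oplus>\<^bsub>A\<^esub>b\<in>B. f b \<odot>\<^bsub>A\<^esub> b)"
  have free: "f \<in> carrier (free_module R B) \<longleftrightarrow> f \<in> B \<rightarrow>\<^sub>E carrier R" for f
    by (simp add: free_module_def)
  have \<iota>: "\<iota> \<in> module_maps R A (free_module R B)"
    unfolding module_maps_def
  proof (intro CollectI conjI ballI)
    show "\<iota> \<in> carrier A \<rightarrow>\<^sub>E carrier (free_module R B)"
      by (auto simp: \<iota>_def free)
    show "\<iota> (x \<oplus>\<^bsub>A\<^esub> y) = \<iota> x \<oplus>\<^bsub>free_module R B\<^esub> \<iota> y" if "x \<in> carrier A" "y \<in> carrier A" for x y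
      using that by (auto simp: \<iota>_def free_module_def A.r_distr s_add fun_eq_iff)
    show "\<iota> (r \<odot>\<^bsub>A\<^esub> x) = r \<odot>\<^bsub>free_module R B\<^esub> \<iota> x" if "r \<in> carrier R" "x \<in> carrier A" for r x
      using that by (auto simp: \<iota>_def free_module_def smult_mult s_smult fun_eq_iff)
  qed
  have \<sigma>: "\<sigma> \<in> module_maps R (free_module R B) A"
    unfolding module_maps_def
  proof (intro CollectI conjI ballI)
    show "\<sigma> \<in> carrier (free_module R B) \<rightarrow>\<^sub>E carrier A"
      by (auto simp: \<sigma>_def free PiE_mem intro!: A.finsum_closed M.smult_closed)
    show "\<sigma> (f \<oplus>\<^bsub>free_module R B\<^esub> h) = \<sigma> f \<oplus>\<^bsub>A\<^esub> \<sigma> h"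
      if f: "f \<in> carrier (free_module R B)" and h: "h \<in> carrier (free_module R B)" for f h
    proof -
      have mem [simp]: "f b \<in> carrier R" "h b \<in> carrier R" if "b \<in> B" for b
        using f h that by (auto simp: free)
      have "f \<oplus>\<^bsub>free_module R B\<^esub> h \<in> carrier (free_module R B)"
        unfolding free by (auto simp: free_module_def)
      moreover have "(\<Oplus>\<^bsub>A\<^esub>b\<in>B. (f \<oplus>\<^bsub>free_module R B\<^esub> h) b \<odot>\<^bsub>A\<^esub> b)
          = (\<Oplus>\<^bsub>A\<^esub>b\<in>B. f b \<odot>\<^bsub>A\<^esub> b \<oplus>\<^bsub>A\<^esub> h b \<odot>\<^bsub>A\<^esub> b)"
        by (rule A.finsum_cong') (auto simp: free_module_def M.smult_l_distr)
      moreover have "\<dots> = (\<Oplus>\<^bsub>A\<^esub>b\<in>B. f b \<odot>\<^bsub>A\<^esub> b) \<oplus>\<^bsub>A\<^esub> (\<Oplus>\<^bsub>A\<^esub>b\<in>B. h b \<odot>\<^bsub>A\<^esub> b)"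
        by (rule A.finsum_addf) auto
      ultimately show ?thesis using f h by (simp add: \<sigma>_def)
    qed
    show "\<sigma> (r \<odot>\<^bsub>free_module R B\<^esub> f) = r \<odot>\<^bsub>A\<^esub> \<sigma> f"
      if r: "r \<in> carrier R" and f: "f \<in> carrier (free_module R B)" for r f
    proof -
      have mem [simp]: "f b \<in> carrier R" if "b \<in> B" for b
        using f that by (auto simp: free)
      have "r \<odot>\<^bsub>free_module R B\<^esub> f \<in> carrier (free_module R B)"
        unfolding free using r by (auto simp: free_module_def)
      moreover have "(\<Oplus>\<^bsub>A\<^esub>b\<in>B. (r \<odot>\<^bsub>free_module R B\<^esub> f) b \<odot>\<^bsub>A\<^esub> b)
          = (\<Oplus>\<^bsub>A\<^esub>b\<in>B. r \<odot>\<^bsub>A\<^esub> (f b \<odot>\<^bsub>A\<^esub> b))"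
        by (rule A.finsum_cong') (use r in \<open>auto simp: free_module_def M.smult_assoc1\<close>)
      moreover have "\<dots> = r \<odot>\<^bsub>A\<^esub> (\<Oplus>\<^bsub>A\<^esub>b\<in>B. f b \<odot>\<^bsub>A\<^esub> b)"
        by (rule M.finsum_smult_ldistr[symmetric]) (use r in auto)
      ultimately show ?thesis using f by (simp add: \<sigma>_def)
    qed
  qed
  have proj: "projective_module R A"
    unfolding projective_module_def
  proof (intro exI[of _ B] bexI[OF _ \<iota>] bexI[OF _ \<sigma>] ballI)
    fix x assume x: "x \<in> carrier A"
    have "\<iota> x \<in> carrier (free_module R B)" using x by (auto simp: \<iota>_def free)
    hence "\<sigma> (\<iota> x) = (\<Oplus>\<^bsub>A\<^esub>b\<in>B. \<iota> x b \<odot>\<^bsub>A\<^esub> b)" by (simp add: \<sigma>_def)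
    also have "\<dots> = (\<Oplus>\<^bsub>A\<^esub>b\<in>B. s (D b \<otimes>\<^bsub>A\<^esub> x) \<odot>\<^bsub>A\<^esub> b)"
      by (rule A.finsum_cong') (use x in \<open>auto simp: \<iota>_def\<close>)
    also have "\<dots> = x" using dual[OF x] by simp
    finally show "\<sigma> (\<iota> x) = x" .
  qed
  define \<Phi> where "\<Phi> = (\<lambda>x. \<lambda>z\<in>carrier A. s (x \<otimes>\<^bsub>A\<^esub> z))"
  have map_finsum: "\<phi> (\<Oplus>\<^bsub>A\<^esub>b\<in>B'. h b) = (\<Oplus>\<^bsub>R\<^esub>b\<in>B'. \<phi> (h b))"
    if \<phi>: "\<phi> \<in> dual_module R A" and fin: "finite B'" and h: "h \<in> B' \<rightarrow> carrier A" for \<phi> B' and h :: "'b \<Rightarrow> 'b"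
    using fin h
  proof (induction B' rule: finite_induct)
    case empty
    have "\<phi> (\<zero>\<^bsub>A\<^esub> \<oplus>\<^bsub>A\<^esub> \<zero>\<^bsub>A\<^esub>) = \<phi> \<zero>\<^bsub>A\<^esub> \<oplus>\<^bsub>R\<^esub> \<phi> \<zero>\<^bsub>A\<^esub>" "\<phi> \<zero>\<^bsub>A\<^esub> \<in> carrier R"
      using \<phi> A.zero_closed by (auto simp: module_maps_def regular_module_def simp del: A.l_zero A.r_zero)
    thus ?case by simp
  next
    case (insert b B')
    have "\<phi> (h b \<oplus>\<^bsub>A\<^esub> (\<Oplus>\<^bsub>A\<^esub>b\<in>B'. h b)) = \<phi> (h b) \<oplus>\<^bsub>R\<^esub> \<phi> (\<Oplus>\<^bsub>A\<^esub>b\<in>B'. h b)"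
      using \<phi> insert.prems by (auto simp: module_maps_def regular_module_def)
    moreover have "(\<lambda>b. \<phi> (h b)) \<in> insert b B' \<rightarrow> carrier R"
      using \<phi> insert.prems by (auto simp: module_maps_def regular_module_def)
    ultimately show ?case using insert by simp
  qed
  have "dual_bimodule_iso R A \<Phi>"
    unfolding dual_bimodule_iso_def
  proof (intro conjI ballI)
    show "bij_betw \<Phi> (carrier A) (dual_module R A)"
      unfolding bij_betw_def
    proof
      show "inj_on \<Phi> (carrier A)"
      proof (rule inj_onI)
        fix x y assume x: "x \<in> carrier A" and y: "y \<in> carrier A" and eq: "\<Phi> x = \<Phi> y"
        have *: "s (D b \<otimes>\<^bsub>A\<^esub> x) = s (D b \<otimes>\<^bsub>A\<^esub> y)" if "b \<in> B" for b
          using fun_cong[OF eq, of "D b"] that x y by (simp add: \<Phi>_def s_comm)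
        have "x = (\<Oplus>\<^bsub>A\<^esub>b\<in>B. s (D b \<otimes>\<^bsub>A\<^esub> x) \<odot>\<^bsub>A\<^esub> b)" by (rule dual[OF x])
        also have "\<dots> = (\<Oplus>\<^bsub>A\<^esub>b\<in>B. s (D b \<otimes>\<^bsub>A\<^esub> y) \<odot>\<^bsub>A\<^esub> b)"
          by (rule A.finsum_cong') (use y in \<open>auto simp: *\<close>)
        also have "\<dots> = y" by (rule dual[OF y, symmetric])
        finally show "x = y" .
      qed
      show "\<Phi> ` carrier A = dual_module R A"
      proof
        show "\<Phi> ` carrier A \<subseteq> dual_module R A"
          by (auto simp: \<Phi>_def module_maps_def regular_module_def A.r_distr s_add smult_mult s_smult)
        show "dual_module R A \<subseteq> \<Phi> ` carrier A"
        proof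
          fix \<phi> assume \<phi>: "\<phi> \<in> dual_module R A"
          have \<phi>_closed [simp]: "\<phi> x \<in> carrier R" if "x \<in> carrier A" for x
            using \<phi> that by (auto simp: module_maps_def regular_module_def)
          have \<phi>_smult: "\<phi> (r \<odot>\<^bsub>A\<^esub> x) = r \<otimes>\<^bsub>R\<^esub> \<phi> x" if "r \<in> carrier R" "x \<in> carrier A" for r x
            using \<phi> that by (auto simp: module_maps_def regular_module_def)
          define a where "a = (\<Oplus>\<^bsub>A\<^esub>b\<in>B. \<phi> b \<odot>\<^bsub>A\<^esub> D b)"
          have a: "a \<in> carrier A" unfolding a_def by (rule A.finsum_closed) auto
          have "\<phi> z = \<Phi> a z" if z: "z \<in> carrier A" for z
          proof -
            have "\<Phi> a z = s (\<Oplus>\<^bsub>A\<^esub>b\<in>B. (\<phi> b \<odot>\<^bsub>A\<^esub> D b) \<otimes>\<^bsub>A\<^esub> z)"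
              unfolding a_def \<Phi>_def using z
              by (simp add: A.finsum_ldistr Pi_def)
            also have "\<dots> = (\<Oplus>\<^bsub>R\<^esub>b\<in>B. s ((\<phi> b \<odot>\<^bsub>A\<^esub> D b) \<otimes>\<^bsub>A\<^esub> z))"
              by (rule map_finsum[OF s B(1)]) (use z in auto)
            also have "\<dots> = (\<Oplus>\<^bsub>R\<^esub>b\<in>B. \<phi> (s (D b \<otimes>\<^bsub>A\<^esub> z) \<odot>\<^bsub>A\<^esub> b))"
              by (rule M.R.finsum_cong') (use z in \<open>auto simp: smult_mult s_smult \<phi>_smult M.R.m_comm\<close>)
            also have "\<dots> = \<phi> (\<Oplus>\<^bsub>A\<^esub>b\<in>B. s (D b \<otimes>\<^bsub>A\<^esub> z) \<odot>\<^bsub>A\<^esub> b)"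
              by (rule map_finsum[OF \<phi> B(1), symmetric]) (use z in auto)
            also have "\<dots> = \<phi> z" using dual[OF z] by simp
            finally show ?thesis by simp
          qed
          moreover have "\<phi> z = \<Phi> a z" if "z \<notin> carrier A" for z
            using \<phi> that by (auto simp: \<Phi>_def module_maps_def)
          ultimately have "\<phi> = \<Phi> a" by blast
          thus "\<phi> \<in> \<Phi> ` carrier A" using a by blast
        qed
      qed
    qed
    show "\<Phi> (x \<oplus>\<^bsub>A\<^esub> y) = (\<lambda>z\<in>carrier A. \<Phi> x z \<oplus>\<^bsub>R\<^esub> \<Phi> y z)"
      if "x \<in> carrier A" "y \<in> carrier A" for x y
      using that by (auto simp: \<Phi>_def A.l_distr s_add fun_eq_iff)
    show "\<Phi> (a \<otimes>\<^bsub>A\<^esub> x \<otimes>\<^bsub>A\<^esub> b) = (\<lambda>z\<in>carrier A. \<Phi> x (b \<otimes>\<^bsub>A\<^esub> z \<otimes>\<^bsub>A\<^esub> a))"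
      if "a \<in> carrier A" "x \<in> carrier A" "b \<in> carrier A" for a x b
    proof -
      have "s (a \<otimes>\<^bsub>A\<^esub> x \<otimes>\<^bsub>A\<^esub> b \<otimes>\<^bsub>A\<^esub> z) = s (x \<otimes>\<^bsub>A\<^esub> (b \<otimes>\<^bsub>A\<^esub> z \<otimes>\<^bsub>A\<^esub> a))" if "z \<in> carrier A" for z
        using s_comm[of a "x \<otimes>\<^bsub>A\<^esub> b \<otimes>\<^bsub>A\<^esub> z"] that \<open>a \<in> _\<close> \<open>x \<in> _\<close> \<open>b \<in> _\<close> by (simp add: A.m_assoc)
      thus ?thesis using that by (auto simp: \<Phi>_def fun_eq_iff)
    qed
  qed
  with alg fg proj show ?thesis unfolding symmetric_algebra_def by blast
qed
section \<open>The valuation ring\<close>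

lemma discrete_valuation_one: "discrete_valuation v \<Longrightarrow> v 1 = 0"
  unfolding discrete_valuation_def by (metis add_cancel_right_right mult_1 one_neq_zero)

lemma discrete_valuation_uminus:
  assumes v: "discrete_valuation v"
  shows "v (- x) = v x"
proof (cases "x = 0")
  case False
  have "v (- 1 * - 1) = v (- 1) + v (- 1)"
    using v unfolding discrete_valuation_def by (metis neg_equal_0_iff_equal one_neq_zero)
  hence "v (- 1) = 0" using discrete_valuation_one[OF v] by simp
  moreover have "v (- 1 * x) = v (- 1) + v x"
    using v False unfolding discrete_valuation_def by (metis neg_equal_0_iff_equal one_neq_zero)
  ultimately show ?thesis by simp
qed simp

lemma valuation_ring_closed:
  assumes v: "discrete_valuation v"
  shows "0 \<in> valuation_ring v" "1 \<in> valuation_ring v"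
    "x \<in> valuation_ring v \<Longrightarrow> y \<in> valuation_ring v \<Longrightarrow> x + y \<in> valuation_ring v"
    "x \<in> valuation_ring v \<Longrightarrow> y \<in> valuation_ring v \<Longrightarrow> x * y \<in> valuation_ring v"
    "x \<in> valuation_ring v \<Longrightarrow> - x \<in> valuation_ring v"
proof -
  show "x + y \<in> valuation_ring v" if "x \<in> valuation_ring v" "y \<in> valuation_ring v"
  proof (cases "x = 0 \<or> y = 0 \<or> x + y = 0")
    case False
    hence "min (v x) (v y) \<le> v (x + y)" using v by (simp add: discrete_valuation_def)
    thus ?thesis using that False by (simp add: valuation_ring_def)
  qed (use that in \<open>auto simp: valuation_ring_def\<close>)
  show "x * y \<in> valuation_ring v" if "x \<in> valuation_ring v" "y \<in> valuation_ring v"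
  proof (cases "x = 0 \<or> y = 0")
    case False
    hence "v (x * y) = v x + v y" using v by (simp add: discrete_valuation_def)
    thus ?thesis using that False by (simp add: valuation_ring_def)
  qed (auto simp: valuation_ring_def)
qed (use v in \<open>auto simp: valuation_ring_def discrete_valuation_one discrete_valuation_uminus\<close>)

text \<open>If \<open>r\<close> had negative valuation, then the valuations of \<open>r\<^sup>k d\<close> would be unbounded below.\<close>

lemma valuation_ring_completely_integrally_closed:
  assumes v: "discrete_valuation v" and d: "d \<noteq> 0" and r: "\<And>k. r ^ k * d \<in> valuation_ring v"
  shows "r \<in> valuation_ring v"
proof (rule ccontr)
  assume "r \<notin> valuation_ring v"
  hence r0: "r \<noteq> 0" and neg: "v r < 0" by (auto simp: valuation_ring_def)
  have mult: "v (x * y) = v x + v y" if "x \<noteq> 0" "y \<noteq> 0" for x y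
    using v that by (simp add: discrete_valuation_def)
  have pow: "v (r ^ k) = int k * v r" for k
    by (induction k) (simp_all add: discrete_valuation_one[OF v] mult r0 algebra_simps)
  define k where "k = Suc (nat (v d))"
  have "0 \<le> int k * v r + v d"
    using r[of k] r0 d mult[of "r ^ k" d] by (simp add: valuation_ring_def pow)
  moreover have "int k * v r \<le> - int k"
    using neg mult_left_mono[of "v r" "-1" "int k"] by simp
  moreover have "v d < int k" unfolding k_def by linarith
  ultimately show False by linarith
qed

section \<open>Characters of irreducible representations\<close>

text \<open>The two relations between values of an absolutely irreducible character on which everything
  below rests. The first one expresses that \<open>e(\<chi>)\<close> is idempotent. The second one is Schur's lemma:
  it says that class sums act as scalars.\<close>

locale irreducible_character = group G for G (structure) +
  fixes \<chi> :: "'a \<Rightarrow> 'k::field_char_0"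
  assumes finite_carrier: "finite (carrier G)"
    and degree_nonzero: "\<chi> \<one> \<noteq> 0"
    and class_function: "x \<in> carrier G \<Longrightarrow> y \<in> carrier G \<Longrightarrow> \<chi> (x \<otimes> y) = \<chi> (y \<otimes> x)"
    and orthogonality: "x \<in> carrier G \<Longrightarrow>
      \<chi> \<one> * (\<Sum>y\<in>carrier G. \<chi> (x \<otimes> inv y) * \<chi> y) = of_nat (Coset.order G) * \<chi> x"
    and functional_equation: "x \<in> carrier G \<Longrightarrow> y \<in> carrier G \<Longrightarrow>
      \<chi> \<one> * (\<Sum>u\<in>carrier G. \<chi> (x \<otimes> (u \<otimes> y \<otimes> inv u))) = of_nat (Coset.order G) * (\<chi> x * \<chi> y)"

lemma mult_mat_entry:
  assumes "A \<in> carrier_mat n n" "B \<in> carrier_mat n n" "i < n" "j < n"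
  shows "(A * B) $$ (i, j) = (\<Sum>k<n. A $$ (i, k) * B $$ (k, j))"
  using assms by (auto simp: scalar_prod_def atLeast0LessThan)

lemma mat_trace_carrier: "A \<in> carrier_mat n n \<Longrightarrow> mat_trace A = (\<Sum>i<n. A $$ (i, i))"
  by (auto simp: mat_trace_def)

lemma mat_trace_mult_commute:
  fixes A B :: "'a::comm_semiring_0 mat"
  assumes A: "A \<in> carrier_mat n n" and B: "B \<in> carrier_mat n n"
  shows "mat_trace (A * B) = mat_trace (B * A)"
proof -
  have "mat_trace (A * B) = (\<Sum>i<n. \<Sum>k<n. A $$ (i, k) * B $$ (k, i))"
    using A B by (subst mat_trace_carrier[of _ n]) (auto simp: mult_mat_entry[OF A B] simp del: index_mult_mat(1))
  also have "\<dots> = (\<Sum>k<n. \<Sum>i<n. B $$ (k, i) * A $$ (i, k))"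
    by (subst sum.swap) (simp add: mult.commute)
  also have "\<dots> = mat_trace (B * A)"
    using A B by (subst mat_trace_carrier[of _ n]) (auto simp: mult_mat_entry[OF B A] simp del: index_mult_mat(1))
  finally show ?thesis .
qed

text \<open>The averaged matrix commutes with the representation, so it is a scalar, which is read off from its
  trace.\<close>

lemma (in group) irreducible_representation_average:
  fixes \<rho> :: "'a \<Rightarrow> 'k::field mat"
  assumes split: "splitting_field TYPE('k) G"
    and irr: "irreducible_representation G n \<rho>"
    and M: "M \<in> carrier_mat n n" and ij: "i < n" "j < n"
  shows "of_nat n * (\<Sum>u\<in>carrier G. (\<rho> u * M * \<rho> (inv u)) $$ (i, j))
    = (if i = j then of_nat (Coset.order G) * mat_trace M else 0)"
proof -
  have \<rho>_carrier [simp]: "\<rho> x \<in> carrier_mat n n" if "x \<in> carrier G" for x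
    using irr that by (auto simp: irreducible_representation_def representation_def hom_def ring_mat_def)
  have \<rho>_mult: "\<rho> (x \<otimes> y) = \<rho> x * \<rho> y" if "x \<in> carrier G" "y \<in> carrier G" for x y
    using irr that by (auto simp: irreducible_representation_def representation_def hom_def ring_mat_def)
  have \<rho>_one: "\<rho> \<one> = 1\<^sub>m n"
    using irr by (auto simp: irreducible_representation_def representation_def)
  define Q where "Q = (\<lambda>u. \<rho> u * M * \<rho> (inv u))"
  have Q [simp]: "Q u \<in> carrier_mat n n" if "u \<in> carrier G" for u
    unfolding Q_def using that M by (intro mult_carrier_mat[of _ n n]) auto
  define S where "S = mat n n (\<lambda>(i, j). \<Sum>u\<in>carrier G. Q u $$ (i, j))"
  have S [simp]: "S \<in> carrier_mat n n" by (simp add: S_def)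
  have S_left: "(A * S) $$ (i, j) = (\<Sum>u\<in>carrier G. (A * Q u) $$ (i, j))"
    if "A \<in> carrier_mat n n" "i < n" "j < n" for A i j
  proof -
    have "(A * S) $$ (i, j) = (\<Sum>k<n. \<Sum>u\<in>carrier G. A $$ (i, k) * Q u $$ (k, j))"
      unfolding mult_mat_entry[OF that(1) S that(2,3)] using that by (simp add: S_def sum_distrib_left)
    also have "\<dots> = (\<Sum>u\<in>carrier G. (A * Q u) $$ (i, j))"
      by (subst sum.swap) (rule sum.cong, simp, rule mult_mat_entry[symmetric], use that in auto)
    finally show ?thesis .
  qed
  have S_right: "(S * A) $$ (i, j) = (\<Sum>u\<in>carrier G. (Q u * A) $$ (i, j))"
    if "A \<in> carrier_mat n n" "i < n" "j < n" for A i j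
  proof -
    have "(S * A) $$ (i, j) = (\<Sum>k<n. \<Sum>u\<in>carrier G. Q u $$ (i, k) * A $$ (k, j))"
      unfolding mult_mat_entry[OF S that] using that by (simp add: S_def sum_distrib_right)
    also have "\<dots> = (\<Sum>u\<in>carrier G. (Q u * A) $$ (i, j))"
      by (subst sum.swap) (rule sum.cong, simp, rule mult_mat_entry[symmetric], use that in auto)
    finally show ?thesis .
  qed
  have "S * \<rho> x = \<rho> x * S" if x: "x \<in> carrier G" for x
  proof (rule eq_matI)
    fix i j assume "i < dim_row (\<rho> x * S)" "j < dim_col (\<rho> x * S)"
    hence ij: "i < n" "j < n" using \<rho>_carrier[OF x] by (auto simp: S_def)
    have shift: "\<rho> x * Q u = Q (x \<otimes> u) * \<rho> x" if u: "u \<in> carrier G" for u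
    proof -
      have "\<rho> (inv (x \<otimes> u)) * \<rho> x = \<rho> (inv u)"
        using x u by (simp add: \<rho>_mult[symmetric] inv_mult_group m_assoc)
      moreover have "Q (x \<otimes> u) * \<rho> x = \<rho> (x \<otimes> u) * M * (\<rho> (inv (x \<otimes> u)) * \<rho> x)"
        unfolding Q_def using x u M
        by (intro assoc_mult_mat[of _ n n _ n _ n] mult_carrier_mat[of _ n n]) auto
      moreover have "\<rho> x * Q u = \<rho> x * \<rho> u * M * \<rho> (inv u)"
        unfolding Q_def using x u M
        by (smt (verit) \<rho>_carrier assoc_mult_mat inv_closed mult_carrier_mat)
      ultimately show ?thesis using x u by (simp add: \<rho>_mult)
    qed
    have bij: "bij_betw (\<lambda>u. x \<otimes> u) (carrier G) (carrier G)"
      by (rule bij_betw_byWitness[where f' = "\<lambda>u. inv x \<otimes> u"])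
         (use x in \<open>auto simp: m_assoc[symmetric]\<close>)
    have "(\<rho> x * S) $$ (i, j) = (\<Sum>u\<in>carrier G. (Q (x \<otimes> u) * \<rho> x) $$ (i, j))"
      unfolding S_left[OF \<rho>_carrier[OF x] ij] by (rule sum.cong) (simp_all add: shift)
    also have "\<dots> = (S * \<rho> x) $$ (i, j)"
      unfolding S_right[OF \<rho>_carrier[OF x] ij]
      by (rule sum.reindex_bij_betw[OF bij, where g = "\<lambda>u. (Q u * \<rho> x) $$ (i, j)"])
    finally show "(S * \<rho> x) $$ (i, j) = (\<rho> x * S) $$ (i, j)" by simp
  qed (use carrier_matD[OF \<rho>_carrier[OF that]] in \<open>auto simp: S_def\<close>)
  then obtain c where c: "S = c \<cdot>\<^sub>m 1\<^sub>m n"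
    using split irr S unfolding splitting_field_def by blast
  have "of_nat n * c = mat_trace S"
    by (simp add: c mat_trace_def)
  also have "\<dots> = (\<Sum>u\<in>carrier G. mat_trace (Q u))"
    unfolding mat_trace_carrier[OF S]
    by (simp add: mat_trace_carrier[OF Q] S_def sum.swap[of _ "carrier G"])
  also have "\<dots> = (\<Sum>u\<in>carrier G. mat_trace M)"
  proof (rule sum.cong)
    fix u assume u: "u \<in> carrier G"
    have "mat_trace (Q u) = mat_trace (\<rho> (inv u) * (\<rho> u * M))"
      unfolding Q_def using u M by (intro mat_trace_mult_commute[of _ n] mult_carrier_mat[of _ n n]) auto
    also have "\<rho> (inv u) * (\<rho> u * M) = \<rho> (inv u \<otimes> u) * M"
      unfolding \<rho>_mult[OF inv_closed[OF u] u]
      by (rule assoc_mult_mat[symmetric, of _ n n _ n _ n]) (use u M in auto)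
    finally show "mat_trace (Q u) = mat_trace M" using u M by (simp add: \<rho>_one)
  qed simp
  finally have "of_nat n * c = of_nat (Coset.order G) * mat_trace M"
    by (simp add: Coset.order_def)
  moreover have "(\<Sum>u\<in>carrier G. Q u $$ (i, j)) = (if i = j then c else 0)"
  proof -
    have "S $$ (i, j) = (c \<cdot>\<^sub>m 1\<^sub>m n) $$ (i, j)" using c by simp
    thus ?thesis using ij by (simp add: S_def)
  qed
  ultimately show ?thesis by (simp add: Q_def)
qed

text \<open>Averaging matrix units gives orthogonality of matrix entries, hence the first relation;
  averaging \<open>\<rho> y\<close> and multiplying by \<open>\<rho> x\<close> gives the second one after taking traces.\<close>

lemma (in group) irreducible_character_Irr:
  fixes \<chi> :: "'a \<Rightarrow> 'k::field_char_0"
  assumes fin: "finite (carrier G)" and split: "splitting_field TYPE('k) G" and \<chi>: "\<chi> \<in> Irr G"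
  shows "irreducible_character G \<chi>"
proof -
  obtain n and \<rho> :: "'a \<Rightarrow> 'k mat" where irr: "irreducible_representation G n \<rho>"
    and \<chi>_def: "\<chi> = (\<lambda>x\<in>carrier G. mat_trace (\<rho> x))"
    using \<chi> by (auto simp: Irr_def)
  have n: "0 < n" using irr by (simp add: irreducible_representation_def)
  have \<rho>_carrier [simp]: "\<rho> x \<in> carrier_mat n n" if "x \<in> carrier G" for x
    using irr that by (auto simp: irreducible_representation_def representation_def hom_def ring_mat_def)
  have \<rho>_mult: "\<rho> (x \<otimes> y) = \<rho> x * \<rho> y" if "x \<in> carrier G" "y \<in> carrier G" for x y
    using irr that by (auto simp: irreducible_representation_def representation_def hom_def ring_mat_def)
  have \<rho>_one: "\<rho> \<one> = 1\<^sub>m n"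
    using irr by (auto simp: irreducible_representation_def representation_def)
  have \<chi>_eq: "\<chi> x = mat_trace (\<rho> x)" if "x \<in> carrier G" for x
    using that by (simp add: \<chi>_def)
  have \<chi>_one: "\<chi> \<one> = of_nat n" by (simp add: \<chi>_eq \<rho>_one mat_trace_def)
  note average = irreducible_representation_average[OF split irr]
  show ?thesis
  proof
    show "finite (carrier G)" by (rule fin)
    show "\<chi> \<one> \<noteq> 0" using n by (simp add: \<chi>_one)
    show "\<chi> (x \<otimes> y) = \<chi> (y \<otimes> x)" if "x \<in> carrier G" "y \<in> carrier G" for x y
      using that mat_trace_mult_commute[of "\<rho> x" n "\<rho> y"] by (simp add: \<chi>_eq \<rho>_mult)
  next
    fix x assume x: "x \<in> carrier G"
    have unit: "(\<rho> y * mat n n (\<lambda>(a, b). if a = k \<and> b = l then 1 else 0) * \<rho> (inv y)) $$ (i, j)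
        = \<rho> y $$ (i, k) * \<rho> (inv y) $$ (l, j)"
      if "y \<in> carrier G" "i < n" "j < n" "k < n" "l < n" for y i j k l
    proof -
      let ?E = "mat n n (\<lambda>(a, b). if a = k \<and> b = l then 1 else 0) :: 'k mat"
      have 1: "(\<rho> y * ?E) $$ (i, b) = (if b = l then \<rho> y $$ (i, k) else 0)" if "b < n" for b
      proof -
        have "(\<rho> y * ?E) $$ (i, b) = (\<Sum>a<n. \<rho> y $$ (i, a) * ?E $$ (a, b))"
          by (rule mult_mat_entry) (use \<open>y \<in> _\<close> \<open>i < n\<close> that in auto)
        also have "\<dots> = (\<Sum>a<n. if a = k then (if b = l then \<rho> y $$ (i, k) else 0) else 0)"
          using that by (intro sum.cong) auto
        finally show ?thesis using \<open>k < n\<close> by simp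
      qed
      have "(\<rho> y * ?E * \<rho> (inv y)) $$ (i, j) = (\<Sum>b<n. (\<rho> y * ?E) $$ (i, b) * \<rho> (inv y) $$ (b, j))"
        by (rule mult_mat_entry) (use that in \<open>auto intro!: mult_carrier_mat[of _ n n]\<close>)
      also have "\<dots> = (\<Sum>b<n. if b = l then \<rho> y $$ (i, k) * \<rho> (inv y) $$ (l, j) else 0)"
        by (intro sum.cong) (auto simp: 1 simp del: index_mult_mat(1))
      finally show ?thesis using that by simp
    qed
    have trace_unit: "mat_trace (mat n n (\<lambda>(a, b). if a = k \<and> b = l then 1 else 0) :: 'k mat) = (if k = l then 1 else 0)"
      if "k < n" "l < n" for k l
    proof -
      have "(\<Sum>i<n. if i = k \<and> i = l then 1 else (0 :: 'k)) = (\<Sum>i<n. if i = k then (if k = l then 1 else 0) else 0)"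
        by (rule sum.cong) auto
      thus ?thesis using that by (simp add: mat_trace_def)
    qed
    have orth: "of_nat n * (\<Sum>y\<in>carrier G. \<rho> y $$ (i, k) * \<rho> (inv y) $$ (l, j))
        = (if i = j \<and> k = l then of_nat (Coset.order G) else 0)"
      if "i < n" "j < n" "k < n" "l < n" for i j k l
      using average[of "mat n n (\<lambda>(a, b). if a = k \<and> b = l then 1 else 0)" i j] that
      by (simp add: unit trace_unit cong: sum.cong)
    have "\<chi> \<one> * (\<Sum>y\<in>carrier G. \<chi> (x \<otimes> inv y) * \<chi> y)
        = of_nat n * (\<Sum>y\<in>carrier G. (\<Sum>j<n. \<Sum>l<n. \<rho> x $$ (j, l) * \<rho> (inv y) $$ (l, j)) * (\<Sum>i<n. \<rho> y $$ (i, i)))"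
      unfolding \<chi>_one
    proof (intro arg_cong2[of _ _ _ _ "(*)"] refl sum.cong)
      fix y assume y: "y \<in> carrier G"
      show "\<chi> y = (\<Sum>i<n. \<rho> y $$ (i, i))" using y by (simp add: \<chi>_eq mat_trace_carrier[of _ n])
      show "\<chi> (x \<otimes> inv y) = (\<Sum>j<n. \<Sum>l<n. \<rho> x $$ (j, l) * \<rho> (inv y) $$ (l, j))"
        using x y by (simp add: \<chi>_eq \<rho>_mult mat_trace_carrier[OF mult_carrier_mat[of _ n n]]
            mult_mat_entry[of _ n] del: index_mult_mat(1))
    qed
    also have "\<dots> = (\<Sum>y\<in>carrier G. \<Sum>j<n. \<Sum>l<n. \<Sum>i<n. \<rho> x $$ (j, l) * (of_nat n * (\<rho> y $$ (i, i) * \<rho> (inv y) $$ (l, j))))"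
      by (simp add: sum_distrib_left sum_distrib_right mult_ac)
    also have "\<dots> = (\<Sum>j<n. \<Sum>l<n. \<Sum>i<n. \<rho> x $$ (j, l) * (of_nat n * (\<Sum>y\<in>carrier G. \<rho> y $$ (i, i) * \<rho> (inv y) $$ (l, j))))"
      by (simp add: sum_distrib_left sum.swap[of _ "carrier G"])
    also have "\<dots> = (\<Sum>j<n. \<Sum>l<n. \<Sum>i<n. if i = j then (if l = j then \<rho> x $$ (j, j) * of_nat (Coset.order G) else 0) else 0)"
      by (intro sum.cong refl) (auto simp: orth)
    also have "\<dots> = of_nat (Coset.order G) * \<chi> x"
      using x by (simp add: \<chi>_eq mat_trace_carrier[of _ n] sum_distrib_left mult_ac)
    finally show "\<chi> \<one> * (\<Sum>y\<in>carrier G. \<chi> (x \<otimes> inv y) * \<chi> y) = of_nat (Coset.order G) * \<chi> x" .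
  next
    fix x y assume x: "x \<in> carrier G" and y: "y \<in> carrier G"
    let ?Q = "\<lambda>u. \<rho> u * \<rho> y * \<rho> (inv u)"
    have Q: "?Q u \<in> carrier_mat n n" if "u \<in> carrier G" for u
      using that y by (intro mult_carrier_mat[of _ n n]) auto
    have "\<chi> \<one> * (\<Sum>u\<in>carrier G. \<chi> (x \<otimes> (u \<otimes> y \<otimes> inv u)))
        = of_nat n * (\<Sum>u\<in>carrier G. \<Sum>i<n. \<Sum>k<n. \<rho> x $$ (i, k) * ?Q u $$ (k, i))"
      unfolding \<chi>_one
    proof (intro arg_cong2[of _ _ _ _ "(*)"] refl sum.cong)
      fix u assume u: "u \<in> carrier G"
      show "\<chi> (x \<otimes> (u \<otimes> y \<otimes> inv u)) = (\<Sum>i<n. \<Sum>k<n. \<rho> x $$ (i, k) * ?Q u $$ (k, i))"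
        using x y u Q[OF u] by (simp add: \<chi>_eq \<rho>_mult mat_trace_carrier[OF mult_carrier_mat[of _ n n]]
            mult_mat_entry[of "\<rho> x" n "?Q u"] del: index_mult_mat(1))
    qed
    also have "\<dots> = (\<Sum>i<n. \<Sum>k<n. \<rho> x $$ (i, k) * (of_nat n * (\<Sum>u\<in>carrier G. ?Q u $$ (k, i))))"
      by (simp add: sum_distrib_left sum.swap[of _ "carrier G"] mult_ac del: index_mult_mat(1))
    also have "\<dots> = (\<Sum>i<n. \<Sum>k<n. if k = i then \<rho> x $$ (i, i) * (of_nat (Coset.order G) * \<chi> y) else 0)"
      using y by (intro sum.cong refl) (auto simp: average \<chi>_eq simp del: index_mult_mat(1))
    also have "\<dots> = of_nat (Coset.order G) * (\<chi> x * \<chi> y)"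
      using x by (simp add: \<chi>_eq mat_trace_carrier[of "\<rho> x" n] sum_distrib_left mult_ac)
    finally show "\<chi> \<one> * (\<Sum>u\<in>carrier G. \<chi> (x \<otimes> (u \<otimes> y \<otimes> inv u))) = of_nat (Coset.order G) * (\<chi> x * \<chi> y)" .
  qed
qed

section \<open>Dual bases in the component of a character\<close>

locale character_over_valuation_ring = irreducible_character G \<chi>
  for G (structure) and \<chi> :: "'a \<Rightarrow> 'k::field_char_0" +
  fixes \<O> :: "'k set" and v :: "'k \<Rightarrow> int"
  assumes valuation: "discrete_valuation v" and \<O>_eq: "\<O> = valuation_ring v"
begin

lemma \<O>_closed [simp, intro]:
  "0 \<in> \<O>" "1 \<in> \<O>" "x \<in> \<O> \<Longrightarrow> y \<in> \<O> \<Longrightarrow> x + y \<in> \<O>" "x \<in> \<O> \<Longrightarrow> y \<in> \<O> \<Longrightarrow> x * y \<in> \<O>"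
  "x \<in> \<O> \<Longrightarrow> - x \<in> \<O>"
  using valuation_ring_closed[OF valuation] by (auto simp: \<O>_eq)

lemma \<O>_sum: "(\<And>i. i \<in> I \<Longrightarrow> f i \<in> \<O>) \<Longrightarrow> (\<Sum>i\<in>I. f i) \<in> \<O>"
  by (induction I rule: infinite_finite_induct) auto

lemma \<O>_power: "x \<in> \<O> \<Longrightarrow> x ^ n \<in> \<O>"
  by (induction n) auto

abbreviation KG where "KG \<equiv> group_algebra (UNIV :: 'k set) G"
abbreviation e where "e \<equiv> char_idempotent G \<chi>"
abbreviation A where "A \<equiv> char_component \<O> G \<chi>"

lemma sum_left_translate:
  assumes "y \<in> carrier G"
  shows "(\<Sum>x\<in>carrier G. F (inv y \<otimes> x)) = (\<Sum>x\<in>carrier G. F x)"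
proof (rule sum.reindex_bij_betw)
  show "bij_betw (\<lambda>x. inv y \<otimes> x) (carrier G) (carrier G)"
    by (rule bij_betw_byWitness[where f' = "\<lambda>x. y \<otimes> x"])
       (use assms in \<open>auto simp: m_assoc[symmetric]\<close>)
qed

lemma conv_apply:
  "(f \<otimes>\<^bsub>KG\<^esub> h) x = (if x \<in> carrier G then (\<Sum>y\<in>carrier G. f y * h (inv y \<otimes> x)) else 0)"
  by (simp add: group_algebra_def)

text \<open>Linear extension of \<open>F\<close> to the group algebra, evaluated at a product. Associativity is the case
  \<open>F z = k (z\<inverse> x)\<close>.\<close>

lemma conv_pairing:
  "(\<Sum>z\<in>carrier G. (f \<otimes>\<^bsub>KG\<^esub> h) z * F z)
     = (\<Sum>x\<in>carrier G. h x * (\<Sum>y\<in>carrier G. f y * F (y \<otimes> x)))"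
proof -
  have "(\<Sum>z\<in>carrier G. (f \<otimes>\<^bsub>KG\<^esub> h) z * F z)
      = (\<Sum>z\<in>carrier G. \<Sum>y\<in>carrier G. f y * h (inv y \<otimes> z) * F z)"
    by (simp add: conv_apply sum_distrib_right)
  also have "\<dots> = (\<Sum>y\<in>carrier G. \<Sum>z\<in>carrier G. f y * h (inv y \<otimes> z) * F (y \<otimes> (inv y \<otimes> z)))"
    by (subst sum.swap) (auto intro!: sum.cong simp: m_assoc[symmetric])
  also have "\<dots> = (\<Sum>y\<in>carrier G. \<Sum>x\<in>carrier G. f y * h x * F (y \<otimes> x))"
    by (intro sum.cong refl sum_left_translate[of _ "\<lambda>x. f _ * h x * F (_ \<otimes> x)"]) auto
  also have "\<dots> = (\<Sum>x\<in>carrier G. h x * (\<Sum>y\<in>carrier G. f y * F (y \<otimes> x)))"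
    by (subst sum.swap) (simp add: sum_distrib_left mult_ac)
  finally show ?thesis .
qed

lemma conv_assoc: "(f \<otimes>\<^bsub>KG\<^esub> h) \<otimes>\<^bsub>KG\<^esub> k = f \<otimes>\<^bsub>KG\<^esub> (h \<otimes>\<^bsub>KG\<^esub> k)"
proof
  fix x
  show "((f \<otimes>\<^bsub>KG\<^esub> h) \<otimes>\<^bsub>KG\<^esub> k) x = (f \<otimes>\<^bsub>KG\<^esub> (h \<otimes>\<^bsub>KG\<^esub> k)) x"
  proof (cases "x \<in> carrier G")
    case True
    have "((f \<otimes>\<^bsub>KG\<^esub> h) \<otimes>\<^bsub>KG\<^esub> k) x
        = (\<Sum>z\<in>carrier G. h z * (\<Sum>y\<in>carrier G. f y * k (inv (y \<otimes> z) \<otimes> x)))"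
      using True by (subst conv_apply) (simp add: conv_pairing)
    also have "\<dots> = (\<Sum>y\<in>carrier G. f y * (\<Sum>z\<in>carrier G. h z * k (inv (y \<otimes> z) \<otimes> x)))"
      unfolding sum_distrib_left by (subst sum.swap) (simp add: mult_ac)
    also have "\<dots> = (f \<otimes>\<^bsub>KG\<^esub> (h \<otimes>\<^bsub>KG\<^esub> k)) x"
      using True by (simp add: conv_apply inv_mult_group m_assoc)
    finally show ?thesis .
  qed (simp add: conv_apply)
qed

lemma conv_linear:
  "(\<lambda>x. f x + f' x) \<otimes>\<^bsub>KG\<^esub> h = (\<lambda>x. (f \<otimes>\<^bsub>KG\<^esub> h) x + (f' \<otimes>\<^bsub>KG\<^esub> h) x)"
  "h \<otimes>\<^bsub>KG\<^esub> (\<lambda>x. f x + f' x) = (\<lambda>x. (h \<otimes>\<^bsub>KG\<^esub> f) x + (h \<otimes>\<^bsub>KG\<^esub> f') x)"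
  "(\<lambda>x. r * f x) \<otimes>\<^bsub>KG\<^esub> h = (\<lambda>x. r * (f \<otimes>\<^bsub>KG\<^esub> h) x)"
  "h \<otimes>\<^bsub>KG\<^esub> (\<lambda>x. r * f x) = (\<lambda>x. r * (h \<otimes>\<^bsub>KG\<^esub> f) x)"
  "(\<lambda>x. - f x) \<otimes>\<^bsub>KG\<^esub> h = (\<lambda>x. - (f \<otimes>\<^bsub>KG\<^esub> h) x)"
  "(\<lambda>x. 0) \<otimes>\<^bsub>KG\<^esub> h = (\<lambda>x. 0)"
  by (auto simp: conv_apply fun_eq_iff algebra_simps sum.distrib sum_distrib_left sum_negf)

abbreviation \<kappa> where "\<kappa> \<equiv> \<chi> \<one> / of_nat (Coset.order G)"

lemma \<kappa>_nonzero: "\<kappa> \<noteq> 0"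
  using degree_nonzero finite_carrier order_gt_0_iff_finite by auto

lemma e_apply: "e x = (if x \<in> carrier G then \<kappa> * \<chi> (inv x) else 0)"
  by (simp add: char_idempotent_def)

lemma conv_e_apply:
  "(f \<otimes>\<^bsub>KG\<^esub> e) x = (if x \<in> carrier G then \<kappa> * (\<Sum>y\<in>carrier G. f y * \<chi> (inv x \<otimes> y)) else 0)"
  by (auto simp: conv_apply e_apply inv_mult_group sum_distrib_left mult_ac intro!: sum.cong)

lemma e_central: "f \<otimes>\<^bsub>KG\<^esub> e = e \<otimes>\<^bsub>KG\<^esub> f"
proof
  fix x
  show "(f \<otimes>\<^bsub>KG\<^esub> e) x = (e \<otimes>\<^bsub>KG\<^esub> f) x"
  proof (cases "x \<in> carrier G")
    case x: True
    have bij: "bij_betw (\<lambda>z. x \<otimes> inv z) (carrier G) (carrier G)"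
      by (rule bij_betw_byWitness[where f' = "\<lambda>z. inv z \<otimes> x"])
         (use x in \<open>auto simp: inv_mult_group m_assoc\<close>, auto simp: m_assoc[symmetric] x)
    have "(e \<otimes>\<^bsub>KG\<^esub> f) x = (\<Sum>z\<in>carrier G. e (x \<otimes> inv z) * f (inv (x \<otimes> inv z) \<otimes> x))"
      using x by (simp add: conv_apply sum.reindex_bij_betw[OF bij, where g = "\<lambda>y. e y * f (inv y \<otimes> x)"])
    also have "\<dots> = (\<Sum>z\<in>carrier G. \<kappa> * (f z * \<chi> (inv x \<otimes> z)))"
    proof (rule sum.cong)
      fix z assume z: "z \<in> carrier G"
      have "inv (x \<otimes> inv z) \<otimes> x = z" "inv (x \<otimes> inv z) = z \<otimes> inv x"
        using x z by (simp_all add: inv_mult_group m_assoc)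
      thus "e (x \<otimes> inv z) * f (inv (x \<otimes> inv z) \<otimes> x) = \<kappa> * (f z * \<chi> (inv x \<otimes> z))"
        using x z class_function[of z "inv x"] by (simp add: e_apply)
    qed simp
    also have "\<dots> = (f \<otimes>\<^bsub>KG\<^esub> e) x" using x by (simp add: conv_e_apply sum_distrib_left)
    finally show ?thesis by simp
  qed (simp add: conv_apply)
qed

lemma e_idem: "e \<otimes>\<^bsub>KG\<^esub> e = e"
proof
  fix x
  show "(e \<otimes>\<^bsub>KG\<^esub> e) x = e x"
  proof (cases "x \<in> carrier G")
    case x: True
    have bij: "bij_betw (\<lambda>z. inv z) (carrier G) (carrier G)"
      by (rule bij_betw_byWitness[where f' = "\<lambda>z. inv z"]) auto
    have "(\<Sum>y\<in>carrier G. e y * \<chi> (inv x \<otimes> y)) = (\<Sum>y\<in>carrier G. \<kappa> * (\<chi> (inv x \<otimes> inv y) * \<chi> y))"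
      by (subst sum.reindex_bij_betw[OF bij, symmetric]) (auto simp: e_apply intro!: sum.cong)
    also have "\<dots> = \<kappa> * (\<Sum>y\<in>carrier G. \<chi> (inv x \<otimes> inv y) * \<chi> y)"
      by (simp add: sum_distrib_left)
    also have "\<dots> = \<chi> (inv x)"
      using orthogonality[of "inv x"] x \<kappa>_nonzero by (simp add: field_simps)
    finally show ?thesis using x by (simp add: conv_e_apply) (simp add: e_apply)
  qed (simp add: conv_apply e_apply)
qed

definition OG :: "('a \<Rightarrow> 'k) set" where "OG = carrier (group_algebra \<O> G)"

lemma OG_iff: "f \<in> OG \<longleftrightarrow> (\<forall>x\<in>carrier G. f x \<in> \<O>) \<and> (\<forall>x. x \<notin> carrier G \<longrightarrow> f x = 0)"
  by (simp add: OG_def group_algebra_def)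

lemma A_simps:
  "carrier A = (\<lambda>f. f \<otimes>\<^bsub>KG\<^esub> e) ` OG" "monoid.mult A = monoid.mult KG" "one A = e"
  "zero A = (\<lambda>x. 0)" "add A = (\<lambda>f h x. f x + h x)" "module.smult A = (\<lambda>r f x. r * f x)"
  by (simp_all add: char_component_def OG_def) (simp_all add: group_algebra_def)

lemma OG_conv: "f \<in> OG \<Longrightarrow> h \<in> OG \<Longrightarrow> f \<otimes>\<^bsub>KG\<^esub> h \<in> OG"
  unfolding OG_iff by (auto simp: conv_apply intro!: \<O>_sum)

lemma conv_e_conv_e: "(f \<otimes>\<^bsub>KG\<^esub> e) \<otimes>\<^bsub>KG\<^esub> (h \<otimes>\<^bsub>KG\<^esub> e) = (f \<otimes>\<^bsub>KG\<^esub> h) \<otimes>\<^bsub>KG\<^esub> e"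
  by (metis conv_assoc e_central e_idem)

lemma A_unital_algebra: "unital_algebra (coeff_ring \<O>) A"
proof -
  have cring: "cring (coeff_ring \<O>)"
  proof (rule cringI)
    show "abelian_group (coeff_ring \<O>)"
      by (rule abelian_groupI) (auto simp: algebra_simps intro: bexI[of _ "- _"])
    show "comm_monoid (coeff_ring \<O>)"
      by (rule comm_monoidI) auto
  qed (auto simp: algebra_simps)
  have ab: "abelian_group A"
  proof (rule abelian_groupI)
    fix x y assume "x \<in> carrier A" "y \<in> carrier A"
    then obtain f h where "f \<in> OG" "x = f \<otimes>\<^bsub>KG\<^esub> e" "h \<in> OG" "y = h \<otimes>\<^bsub>KG\<^esub> e"
      by (auto simp: A_simps)
    moreover from this have "(\<lambda>z. f z + h z) \<in> OG" by (auto simp: OG_iff)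
    ultimately show "x \<oplus>\<^bsub>A\<^esub> y \<in> carrier A"
      by (auto simp: A_simps conv_linear intro!: image_eqI[of _ _ "\<lambda>z. f z + h z"])
  next
    have "(\<lambda>x. 0) \<in> OG" by (auto simp: OG_iff)
    thus "\<zero>\<^bsub>A\<^esub> \<in> carrier A"
      by (auto simp: A_simps conv_linear intro!: image_eqI[of _ _ "\<lambda>x. 0"])
  next
    fix x assume "x \<in> carrier A"
    then obtain f where f: "f \<in> OG" "x = f \<otimes>\<^bsub>KG\<^esub> e" by (auto simp: A_simps)
    hence "(\<lambda>z. - f z) \<in> OG" by (auto simp: OG_iff)
    hence "(\<lambda>z. - f z) \<otimes>\<^bsub>KG\<^esub> e \<in> carrier A" unfolding A_simps(1) by (rule imageI)
    thus "\<exists>y\<in>carrier A. y \<oplus>\<^bsub>A\<^esub> x = \<zero>\<^bsub>A\<^esub>"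
      by (rule bexI[rotated]) (simp add: A_simps(4,5) conv_linear(5) f(2))
  qed (auto simp: A_simps algebra_simps)
  have ring: "ring A"
  proof (rule ringI[OF ab])
    show "monoid A"
    proof (rule monoidI)
      show "x \<otimes>\<^bsub>A\<^esub> y \<in> carrier A" if "x \<in> carrier A" "y \<in> carrier A" for x y
        using that by (auto simp: A_simps conv_e_conv_e intro!: imageI OG_conv)
      have "(\<lambda>x. if x = \<one> then 1 else 0) \<otimes>\<^bsub>KG\<^esub> e = e"
        by (auto simp: fun_eq_iff conv_e_apply e_apply finite_carrier if_distrib[of "\<lambda>t. t * _"] cong: if_cong)
      moreover have "(\<lambda>x. if x = \<one> then 1 else 0) \<in> OG" by (auto simp: OG_iff)
      ultimately show "\<one>\<^bsub>A\<^esub> \<in> carrier A" by (force simp: A_simps)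
      have e_right: "x \<otimes>\<^bsub>KG\<^esub> e = x" if "x \<in> carrier A" for x
        using that by (auto simp: A_simps conv_assoc e_idem)
      show "x \<otimes>\<^bsub>A\<^esub> \<one>\<^bsub>A\<^esub> = x" "\<one>\<^bsub>A\<^esub> \<otimes>\<^bsub>A\<^esub> x = x" if "x \<in> carrier A" for x
        using e_right[OF that] e_central[of x] by (simp_all add: A_simps)
    qed (auto simp: A_simps conv_assoc)
  qed (auto simp: A_simps conv_linear)
  have "Module.module (coeff_ring \<O>) A"
  proof (rule moduleI[OF cring ab])
    fix r x assume "r \<in> carrier (coeff_ring \<O>)" "x \<in> carrier A"
    then obtain f where "r \<in> \<O>" "f \<in> OG" "x = f \<otimes>\<^bsub>KG\<^esub> e" by (auto simp: A_simps)
    moreover from this have "(\<lambda>z. r * f z) \<in> OG" by (auto simp: OG_iff)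
    ultimately show "r \<odot>\<^bsub>A\<^esub> x \<in> carrier A"
      by (auto simp: A_simps conv_linear intro!: image_eqI[of _ _ "\<lambda>z. r * f z"])
  qed (auto simp: A_simps algebra_simps)
  with ring show ?thesis unfolding unital_algebra_def by (auto simp: A_simps conv_linear)
qed

lemma A_finsum:
  assumes "finite I" "F \<in> I \<rightarrow> carrier A"
  shows "(\<Oplus>\<^bsub>A\<^esub>i\<in>I. F i) = (\<lambda>x. \<Sum>i\<in>I. F i x)"
proof -
  interpret A: ring A using A_unital_algebra by (simp add: unital_algebra_def)
  show ?thesis using assms by (induction I rule: finite_induct) (auto simp: A_simps(4,5))
qed

text \<open>Put \<open>X x = x e(\<chi>)\<close> and \<open>b\<^sub>j = \<Sum> \<beta> j y \<cdot> X y\<close>. The form is \<open>s (X x) = c \<cdot> \<chi> x\<close>, which up to a constant is the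
  coefficient at \<open>\<one>\<close> and so is symmetric. The value of \<open>X x\<close> at \<open>w\<inverse>\<close> is a constant times
  \<open>\<chi> (w x)\<close>, hence the assumption \<open>dual\<close> says \<open>X x = \<Sum>\<^sub>j s (b\<^sub>j X x) \<cdot> X j\<close>. The assumption \<open>inj\<close> says that the
  elements \<open>X j\<close> are distinct, so that they can be indexed by themselves.\<close>

lemma symmetric_if_dual_family:
  assumes J: "J \<subseteq> carrier G"
    and inj: "\<And>i j. i \<in> J \<Longrightarrow> j \<in> J \<Longrightarrow> (\<And>w. w \<in> carrier G \<Longrightarrow> \<chi> (w \<otimes> i) = \<chi> (w \<otimes> j)) \<Longrightarrow> i = j"
    and \<beta>: "\<And>j y. j \<in> J \<Longrightarrow> y \<in> carrier G \<Longrightarrow> \<beta> j y \<in> \<O>"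
    and c: "\<And>x. x \<in> carrier G \<Longrightarrow> c * \<chi> x \<in> \<O>"
    and dual: "\<And>w x. w \<in> carrier G \<Longrightarrow> x \<in> carrier G \<Longrightarrow>
      \<chi> (w \<otimes> x) = c * (\<Sum>j\<in>J. (\<Sum>y\<in>carrier G. \<beta> j y * \<chi> (y \<otimes> x)) * \<chi> (w \<otimes> j))"
  shows "symmetric_algebra (coeff_ring \<O>) A"
proof -
  define X where "X = (\<lambda>j. (\<lambda>x. if x = j then 1 else 0) \<otimes>\<^bsub>KG\<^esub> e)"
  define b where "b = (\<lambda>j. (\<lambda>x. if x \<in> carrier G then \<beta> j x else 0))"
  define s where "s = (\<lambda>a\<in>carrier A. c / \<kappa> * a \<one>)"
  have X_apply: "X j w = \<kappa> * \<chi> (inv w \<otimes> j)" if "j \<in> carrier G" "w \<in> carrier G" for j w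
    using that unfolding X_def
    by (simp add: conv_e_apply finite_carrier if_distrib[of "\<lambda>t. t * _"] cong: if_cong)
  have X_carrier: "X j \<in> carrier A" if "j \<in> J" for j
    using that J unfolding X_def A_simps by (auto simp: OG_iff)
  have b_OG: "b j \<in> OG" if "j \<in> J" for j using \<beta> that by (auto simp: b_def OG_iff)
  have X_inj: "inj_on X J"
  proof (rule inj_onI)
    fix i j assume ij: "i \<in> J" "j \<in> J" "X i = X j"
    show "i = j"
    proof (rule inj[OF ij(1,2)])
      fix w assume w: "w \<in> carrier G"
      have "i \<in> carrier G" "j \<in> carrier G" using ij J by auto
      hence "\<kappa> * \<chi> (w \<otimes> i) = \<kappa> * \<chi> (w \<otimes> j)"
        using ij(3) w by (metis X_apply inv_closed inv_inv)
      thus "\<chi> (w \<otimes> i) = \<chi> (w \<otimes> j)" using \<kappa>_nonzero degree_nonzero by auto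
    qed
  qed
  define D where "D = (\<lambda>a. b (inv_into J X a) \<otimes>\<^bsub>KG\<^esub> e)"
  have D_X: "D (X j) = b j \<otimes>\<^bsub>KG\<^esub> e" if "j \<in> J" for j
    using that X_inj by (simp add: D_def)
  have finJ: "finite J" using J finite_carrier finite_subset by blast
  have s_eq: "s (f \<otimes>\<^bsub>KG\<^esub> e) = c * (\<Sum>y\<in>carrier G. f y * \<chi> y)" if "f \<in> OG" for f
  proof -
    have "f \<otimes>\<^bsub>KG\<^esub> e \<in> carrier A" using that by (auto simp: A_simps)
    thus ?thesis using \<kappa>_nonzero by (simp add: s_def conv_e_apply)
  qed
  have conv_carrier: "f \<otimes>\<^bsub>KG\<^esub> h \<in> carrier A" if "f \<in> carrier A" "h \<in> carrier A" for f h
    using that by (auto simp: A_simps conv_e_conv_e intro!: imageI OG_conv)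
  interpret M: Module.module "coeff_ring \<O>" A using A_unital_algebra by (simp add: unital_algebra_def)
  show ?thesis
  proof (rule symmetric_algebraI[OF A_unital_algebra, of s "X ` J" D])
    show "s \<in> module_maps (coeff_ring \<O>) A (regular_module (coeff_ring \<O>))"
      unfolding module_maps_def
    proof (intro CollectI conjI ballI)
      have "s a \<in> \<O>" if a: "a \<in> carrier A" for a
      proof -
        obtain f where f: "f \<in> OG" "a = f \<otimes>\<^bsub>KG\<^esub> e" using a by (auto simp: A_simps)
        have "(\<Sum>y\<in>carrier G. f y * (c * \<chi> y)) \<in> \<O>"
          using f c by (intro \<O>_sum) (auto simp: OG_iff)
        thus ?thesis using f by (simp add: s_eq sum_distrib_left mult_ac)
      qed
      thus "s \<in> carrier A \<rightarrow>\<^sub>E carrier (regular_module (coeff_ring \<O>))"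
        by (auto simp: regular_module_def s_def)
      show "s (x \<oplus>\<^bsub>A\<^esub> y) = s x \<oplus>\<^bsub>regular_module (coeff_ring \<O>)\<^esub> s y"
        if "x \<in> carrier A" "y \<in> carrier A" for x y
        using that M.a_closed[OF that] by (simp add: s_def regular_module_def A_simps(5) algebra_simps add_divide_distrib)
      show "s (r \<odot>\<^bsub>A\<^esub> x) = r \<odot>\<^bsub>regular_module (coeff_ring \<O>)\<^esub> s x"
        if "r \<in> carrier (coeff_ring \<O>)" "x \<in> carrier A" for r x
        using that M.smult_closed[OF that] by (simp add: s_def regular_module_def A_simps(6))
    qed
    show "s (x \<otimes>\<^bsub>A\<^esub> y) = s (y \<otimes>\<^bsub>A\<^esub> x)" if "x \<in> carrier A" "y \<in> carrier A" for x y
    proof -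
      have bij: "bij_betw (\<lambda>z. inv z) (carrier G) (carrier G)"
        by (rule bij_betw_byWitness[where f' = "\<lambda>z. inv z"]) auto
      have "(\<Sum>z\<in>carrier G. x z * y (inv z)) = (\<Sum>z\<in>carrier G. y z * x (inv z))"
        by (subst sum.reindex_bij_betw[OF bij, symmetric]) (auto intro!: sum.cong)
      thus ?thesis using conv_carrier that by (simp add: s_def A_simps(2) conv_apply cong: sum.cong)
    qed
    show "finite (X ` J)" using finJ by simp
    show "X ` J \<subseteq> carrier A" using X_carrier by blast
    show "D \<in> X ` J \<rightarrow> carrier A" using b_OG by (auto simp: D_X A_simps)
    fix a assume "a \<in> carrier A"
    then obtain f where f: "f \<in> OG" "a = f \<otimes>\<^bsub>KG\<^esub> e" by (auto simp: A_simps)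
    define t where "t = (\<lambda>j. c * (\<Sum>x\<in>carrier G. f x * (\<Sum>y\<in>carrier G. \<beta> j y * \<chi> (y \<otimes> x))))"
    have s_D: "s (D (X j) \<otimes>\<^bsub>A\<^esub> a) = t j" if "j \<in> J" for j
    proof -
      have "s (D (X j) \<otimes>\<^bsub>A\<^esub> a) = s ((b j \<otimes>\<^bsub>KG\<^esub> f) \<otimes>\<^bsub>KG\<^esub> e)"
        using that f by (simp add: D_X A_simps(2) conv_e_conv_e)
      also have "\<dots> = c * (\<Sum>y\<in>carrier G. (b j \<otimes>\<^bsub>KG\<^esub> f) y * \<chi> y)"
        using that f b_OG by (intro s_eq OG_conv) auto
      also have "\<dots> = t j"
        unfolding conv_pairing t_def by (simp add: b_def)
      finally show ?thesis .
    qed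
    have t_O: "t j \<in> \<O>" if "j \<in> J" for j
    proof -
      have inner: "(\<Sum>y\<in>carrier G. \<beta> j y * (c * \<chi> (y \<otimes> x))) \<in> \<O>" if "x \<in> carrier G" for x
        by (rule \<O>_sum, rule \<O>_closed(4)[OF \<beta> c]) (use that \<open>j \<in> J\<close> in auto)
      have "(\<Sum>x\<in>carrier G. f x * (\<Sum>y\<in>carrier G. \<beta> j y * (c * \<chi> (y \<otimes> x)))) \<in> \<O>"
        by (rule \<O>_sum, rule \<O>_closed(4)[OF _ inner]) (use f in \<open>simp_all add: OG_iff\<close>)
      thus ?thesis unfolding t_def by (simp add: sum_distrib_left mult_ac)
    qed
    have "(\<Oplus>\<^bsub>A\<^esub>x\<in>X ` J. s (D x \<otimes>\<^bsub>A\<^esub> a) \<odot>\<^bsub>A\<^esub> x) = (\<lambda>w. \<Sum>x\<in>X ` J. (s (D x \<otimes>\<^bsub>A\<^esub> a) \<odot>\<^bsub>A\<^esub> x) w)"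
      using finJ X_carrier t_O by (intro A_finsum) (auto simp: s_D intro!: M.smult_closed)
    also have "\<dots> = (\<lambda>w. \<Sum>j\<in>J. t j * X j w)"
      by (simp add: sum.reindex[OF X_inj] s_D A_simps(6) cong: sum.cong)
    also have "\<dots> = a"
    proof
      fix w
      show "(\<Sum>j\<in>J. t j * X j w) = a w"
      proof (cases "w \<in> carrier G")
        case w: True
        have "(\<Sum>j\<in>J. t j * X j w) = (\<Sum>j\<in>J. t j * (\<kappa> * \<chi> (inv w \<otimes> j)))"
          using w J by (auto intro!: sum.cong simp: X_apply)
        also have "\<dots> = (\<Sum>j\<in>J. \<Sum>x\<in>carrier G. \<kappa> * f x * (c * ((\<Sum>y\<in>carrier G. \<beta> j y * \<chi> (y \<otimes> x)) * \<chi> (inv w \<otimes> j))))"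
          by (simp add: t_def sum_distrib_left sum_distrib_right mult_ac)
        also have "\<dots> = (\<Sum>x\<in>carrier G. \<kappa> * f x * (c * (\<Sum>j\<in>J. (\<Sum>y\<in>carrier G. \<beta> j y * \<chi> (y \<otimes> x)) * \<chi> (inv w \<otimes> j))))"
          by (subst sum.swap) (simp add: sum_distrib_left)
        also have "\<dots> = (\<Sum>x\<in>carrier G. \<kappa> * f x * \<chi> (inv w \<otimes> x))"
          using w by (intro sum.cong refl) (simp add: dual[symmetric])
        also have "\<dots> = a w" using w f by (simp add: conv_e_apply sum_distrib_left mult_ac)
        finally show ?thesis .
      next
        case False
        hence "X j w = 0" for j by (simp add: X_def conv_apply)
        thus ?thesis using False f by (simp add: conv_apply)
      qed
    qed
    finally show "a = (\<Oplus>\<^bsub>A\<^esub>x\<in>X ` J. s (D x \<otimes>\<^bsub>A\<^esub> a) \<odot>\<^bsub>A\<^esub> x)" by simp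
  qed
qed

end

section \<open>Characters for which group elements commute up to scalars\<close>

context irreducible_character
begin

lemma cancel_left [simp]:
  "u \<in> carrier G \<Longrightarrow> x \<in> carrier G \<Longrightarrow> inv u \<otimes> (u \<otimes> x) = x"
  "u \<in> carrier G \<Longrightarrow> x \<in> carrier G \<Longrightarrow> u \<otimes> (inv u \<otimes> x) = x"
  by (simp_all add: m_assoc[symmetric])

text \<open>The image of \<open>z\<close> in the component of \<open>\<chi>\<close> is a multiple of the identity.\<close>

definition scalar :: "'a \<Rightarrow> bool" where
  "scalar z \<longleftrightarrow> (\<exists>\<omega>. \<forall>x\<in>carrier G. \<chi> (x \<otimes> z) = \<omega> * \<chi> x)"

definition commute_up_to_scalar :: "'a \<Rightarrow> 'a \<Rightarrow> bool" where
  "commute_up_to_scalar u x \<longleftrightarrow>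
     (\<exists>\<omega>. \<omega> \<noteq> 0 \<and> (\<forall>w\<in>carrier G. \<chi> (w \<otimes> (u \<otimes> x)) = \<omega> * \<chi> (w \<otimes> (x \<otimes> u))))"

text \<open>Sum the functional equation over the family: every conjugate contributes the same amount, so the
  average over the group can be dropped.\<close>

lemma conjugation_invariant_sum_scalar:
  assumes s: "\<And>i. i \<in> I \<Longrightarrow> s i \<in> carrier G"
    and inv: "\<And>x u. x \<in> carrier G \<Longrightarrow> u \<in> carrier G \<Longrightarrow>
      (\<Sum>i\<in>I. \<chi> (x \<otimes> (u \<otimes> s i \<otimes> inv u))) = (\<Sum>i\<in>I. \<chi> (x \<otimes> s i))"
  shows "\<exists>c. \<forall>x\<in>carrier G. (\<Sum>i\<in>I. \<chi> (x \<otimes> s i)) = c * \<chi> x"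
proof (intro exI ballI)
  fix x assume x: "x \<in> carrier G"
  have "of_nat (Coset.order G) * (\<chi> \<one> * (\<Sum>i\<in>I. \<chi> (x \<otimes> s i)))
      = \<chi> \<one> * (\<Sum>u\<in>carrier G. \<Sum>i\<in>I. \<chi> (x \<otimes> (u \<otimes> s i \<otimes> inv u)))"
    using x by (simp add: inv Coset.order_def)
  also have "\<dots> = (\<Sum>i\<in>I. \<chi> \<one> * (\<Sum>u\<in>carrier G. \<chi> (x \<otimes> (u \<otimes> s i \<otimes> inv u))))"
    by (subst sum.swap) (simp add: sum_distrib_left)
  also have "\<dots> = of_nat (Coset.order G) * (\<chi> x * (\<Sum>i\<in>I. \<chi> (s i)))"
    using x s by (simp add: functional_equation cong: sum.cong) (simp add: sum_distrib_left)
  finally have "\<chi> \<one> * (\<Sum>i\<in>I. \<chi> (x \<otimes> s i)) = \<chi> x * (\<Sum>i\<in>I. \<chi> (s i))"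
    using finite_carrier order_gt_0_iff_finite by auto
  thus "(\<Sum>i\<in>I. \<chi> (x \<otimes> s i)) = (\<Sum>i\<in>I. \<chi> (s i)) / \<chi> \<one> * \<chi> x"
    using degree_nonzero by (simp add: field_simps)
qed

lemma conjugation_invariant_scalar:
  assumes "z \<in> carrier G"
    and "\<And>x u. x \<in> carrier G \<Longrightarrow> u \<in> carrier G \<Longrightarrow> \<chi> (x \<otimes> (u \<otimes> z \<otimes> inv u)) = \<chi> (x \<otimes> z)"
  shows "scalar z"
  using conjugation_invariant_sum_scalar[of "{()}" "\<lambda>_. z"] assms by (simp add: scalar_def)

lemma commute_up_to_scalar_sym:
  assumes "commute_up_to_scalar u x"
  shows "commute_up_to_scalar x u"
proof -
  obtain \<omega> where "\<omega> \<noteq> 0" "\<And>w. w \<in> carrier G \<Longrightarrow> \<chi> (w \<otimes> (u \<otimes> x)) = \<omega> * \<chi> (w \<otimes> (x \<otimes> u))"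
    using assms unfolding commute_up_to_scalar_def by blast
  thus ?thesis unfolding commute_up_to_scalar_def by (intro exI[of _ "1 / \<omega>"]) simp
qed

lemma subgroup_commute_up_to_scalar:
  assumes x: "x \<in> carrier G"
  shows "subgroup {u \<in> carrier G. commute_up_to_scalar u x} G"
proof (rule subgroupI)
  have "commute_up_to_scalar \<one> x"
    using x unfolding commute_up_to_scalar_def by (intro exI[of _ 1]) simp
  thus "{u \<in> carrier G. commute_up_to_scalar u x} \<noteq> {}" by blast
next
  fix u assume u: "u \<in> {u \<in> carrier G. commute_up_to_scalar u x}"
  then obtain \<omega> where \<omega>: "\<omega> \<noteq> 0"
    and eq: "\<And>w. w \<in> carrier G \<Longrightarrow> \<chi> (w \<otimes> (u \<otimes> x)) = \<omega> * \<chi> (w \<otimes> (x \<otimes> u))"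
    unfolding commute_up_to_scalar_def by blast
  have "\<chi> (w \<otimes> (inv u \<otimes> x)) = 1 / \<omega> * \<chi> (w \<otimes> (x \<otimes> inv u))" if w: "w \<in> carrier G" for w
    using eq[of "inv u \<otimes> w \<otimes> inv u"] u w x \<omega> class_function[of "inv u" "w \<otimes> x"]
      class_function[of "inv u" "w \<otimes> (inv u \<otimes> (x \<otimes> u))"]
    by (simp add: m_assoc)
  thus "inv u \<in> {u \<in> carrier G. commute_up_to_scalar u x}"
    using u \<omega> unfolding commute_up_to_scalar_def by (auto intro!: exI[of _ "1 / \<omega>"])
next
  fix u u' assume u: "u \<in> {u \<in> carrier G. commute_up_to_scalar u x}"
    and u': "u' \<in> {u \<in> carrier G. commute_up_to_scalar u x}"
  obtain \<omega> where \<omega>: "\<omega> \<noteq> 0"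
    and eq: "\<And>w. w \<in> carrier G \<Longrightarrow> \<chi> (w \<otimes> (u \<otimes> x)) = \<omega> * \<chi> (w \<otimes> (x \<otimes> u))"
    using u unfolding commute_up_to_scalar_def by blast
  obtain \<omega>' where \<omega>': "\<omega>' \<noteq> 0"
    and eq': "\<And>w. w \<in> carrier G \<Longrightarrow> \<chi> (w \<otimes> (u' \<otimes> x)) = \<omega>' * \<chi> (w \<otimes> (x \<otimes> u'))"
    using u' unfolding commute_up_to_scalar_def by blast
  have "\<chi> (w \<otimes> (u \<otimes> u' \<otimes> x)) = \<omega>' * \<omega> * \<chi> (w \<otimes> (x \<otimes> (u \<otimes> u')))" if w: "w \<in> carrier G" for w
    using eq'[of "w \<otimes> u"] eq[of "u' \<otimes> w"] u u' x w
      class_function[of u' "w \<otimes> (u \<otimes> x)"] class_function[of u' "w \<otimes> (x \<otimes> u)"]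
    by (simp add: m_assoc)
  thus "u \<otimes> u' \<in> {u \<in> carrier G. commute_up_to_scalar u x}"
    using u u' \<omega> \<omega>' unfolding commute_up_to_scalar_def by (auto intro!: exI[of _ "\<omega>' * \<omega>"])
qed auto

lemma subgroup_conjugation_invariant:
  assumes z: "z \<in> carrier G"
  shows "subgroup {u \<in> carrier G. \<forall>x\<in>carrier G. \<chi> (x \<otimes> (u \<otimes> z \<otimes> inv u)) = \<chi> (x \<otimes> z)} G"
    (is "subgroup ?H G")
proof (rule subgroupI)
  have "\<one> \<in> ?H" using z by simp
  thus "?H \<noteq> {}" by blast
next
  fix u assume u: "u \<in> ?H"
  have "\<chi> (x \<otimes> (inv u \<otimes> z \<otimes> u)) = \<chi> (x \<otimes> z)" if x: "x \<in> carrier G" for x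
  proof -
    have "\<chi> (x \<otimes> (inv u \<otimes> z \<otimes> u)) = \<chi> (u \<otimes> x \<otimes> inv u \<otimes> z)"
      using u x z class_function[of u "x \<otimes> (inv u \<otimes> z)"] by (simp add: m_assoc)
    also have "\<dots> = \<chi> (u \<otimes> x \<otimes> inv u \<otimes> (u \<otimes> z \<otimes> inv u))" using u x by simp
    also have "\<dots> = \<chi> (x \<otimes> z)" 
      using u x z class_function[of u "x \<otimes> (z \<otimes> inv u)"] by (simp add: m_assoc)
    finally show ?thesis .
  qed
  thus "inv u \<in> ?H" using u by auto
next
  fix u u' assume u: "u \<in> ?H" and u': "u' \<in> ?H"
  have "\<chi> (x \<otimes> (u \<otimes> u' \<otimes> z \<otimes> inv (u \<otimes> u'))) = \<chi> (x \<otimes> z)" if x: "x \<in> carrier G" for x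
  proof -
    have "\<chi> (x \<otimes> (u \<otimes> u' \<otimes> z \<otimes> inv (u \<otimes> u'))) = \<chi> (inv u \<otimes> x \<otimes> u \<otimes> (u' \<otimes> z \<otimes> inv u'))"
      using u u' x z class_function[of "inv u" "x \<otimes> (u \<otimes> (u' \<otimes> (z \<otimes> inv u')))"]
      by (simp add: m_assoc inv_mult_group)
    also have "\<dots> = \<chi> (inv u \<otimes> x \<otimes> u \<otimes> z)" using u u' x by simp
    also have "\<dots> = \<chi> (x \<otimes> (u \<otimes> z \<otimes> inv u))"
      using u x z class_function[of "inv u" "x \<otimes> (u \<otimes> z)"] by (simp add: m_assoc)
    finally show ?thesis using u x by simp
  qed
  thus "u \<otimes> u' \<in> ?H" using u u' by auto
qed auto

text \<open>If \<open>u x u\<inverse>\<close> and \<open>x\<close> act by proportional operators, then the factor is \<open>1\<close>, as both have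
  the same trace \<open>\<chi> x \<noteq> 0\<close>. So \<open>x\<close> acts centrally.\<close>

lemma scalar_if_nonzero:
  assumes x: "x \<in> carrier G" "\<chi> x \<noteq> 0"
    and comm: "\<And>u. u \<in> carrier G \<Longrightarrow> commute_up_to_scalar u x"
  shows "scalar x"
proof (rule conjugation_invariant_scalar[OF x(1)])
  fix w u assume w: "w \<in> carrier G" and u: "u \<in> carrier G"
  obtain \<omega> where eq: "\<And>w. w \<in> carrier G \<Longrightarrow> \<chi> (w \<otimes> (u \<otimes> x)) = \<omega> * \<chi> (w \<otimes> (x \<otimes> u))"
    using comm[OF u] unfolding commute_up_to_scalar_def by blast
  have "\<omega> = 1"
    using eq[of "inv u"] u x class_function[of "inv u" "x \<otimes> u"] by (simp add: m_assoc)
  thus "\<chi> (w \<otimes> (u \<otimes> x \<otimes> inv u)) = \<chi> (w \<otimes> x)"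
    using eq[of "inv u \<otimes> w"] u w x class_function[of "inv u" "w \<otimes> (u \<otimes> x)"]
      class_function[of "inv u" "w \<otimes> (x \<otimes> u)"] by (simp add: m_assoc)
qed

lemma subgroup_scalar: "subgroup {z \<in> carrier G. scalar z} G"
proof (rule subgroupI)
  have "\<one> \<in> {z \<in> carrier G. scalar z}" unfolding scalar_def by (auto intro!: exI[of _ 1])
  thus "{z \<in> carrier G. scalar z} \<noteq> {}" by blast
next
  fix z assume "z \<in> {z \<in> carrier G. scalar z}"
  then obtain \<omega> where z: "z \<in> carrier G" and \<omega>: "\<And>x. x \<in> carrier G \<Longrightarrow> \<chi> (x \<otimes> z) = \<omega> * \<chi> x"
    by (auto simp: scalar_def)
  have "\<omega> \<noteq> 0" using \<omega>[of "inv z"] z degree_nonzero by auto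
  moreover have "\<chi> x = \<omega> * \<chi> (x \<otimes> inv z)" if "x \<in> carrier G" for x
    using \<omega>[of "x \<otimes> inv z"] that z by (simp add: m_assoc)
  ultimately show "inv z \<in> {z \<in> carrier G. scalar z}"
    using z unfolding scalar_def by (auto intro!: exI[of _ "1 / \<omega>"])
next
  fix z z' assume "z \<in> {z \<in> carrier G. scalar z}" "z' \<in> {z \<in> carrier G. scalar z}"
  then obtain \<omega> \<omega>' where z: "z \<in> carrier G" "z' \<in> carrier G"
    and \<omega>: "\<And>x. x \<in> carrier G \<Longrightarrow> \<chi> (x \<otimes> z) = \<omega> * \<chi> x"
    and \<omega>': "\<And>x. x \<in> carrier G \<Longrightarrow> \<chi> (x \<otimes> z') = \<omega>' * \<chi> x"
    by (auto simp: scalar_def)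
  have "\<chi> (x \<otimes> (z \<otimes> z')) = \<omega>' * \<omega> * \<chi> x" if "x \<in> carrier G" for x
    using \<omega>[of x] \<omega>'[of "x \<otimes> z"] that z by (simp add: m_assoc)
  thus "z \<otimes> z' \<in> {z \<in> carrier G. scalar z}"
    using z unfolding scalar_def by (auto intro!: exI[of _ "\<omega>' * \<omega>"])
qed auto

end

context character_over_valuation_ring
begin

text \<open>Iterating the relation writes \<open>r\<^sup>k \<chi> w\<close> as an \<open>\<O>\<close>-linear combination of character values, which have a
  common denominator \<open>q\<close>. Thus scalars in the image of \<open>\<O>P\<close> lie in \<open>\<O>\<close>.\<close>

lemma scalar_integral:
  assumes s: "\<And>i. i \<in> I \<Longrightarrow> s i \<in> carrier G" and \<beta>: "\<And>i. i \<in> I \<Longrightarrow> \<beta> i \<in> \<O>"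
    and r: "\<And>w. w \<in> carrier G \<Longrightarrow> r * \<chi> w = (\<Sum>i\<in>I. \<beta> i * \<chi> (w \<otimes> s i))"
  shows "r \<in> \<O>"
proof -
  obtain q where q: "q \<noteq> 0" "v q = (\<Sum>x\<in>carrier G. \<bar>v (\<chi> x)\<bar>)"
    using valuation unfolding discrete_valuation_def by blast
  have bounded: "q * \<chi> x \<in> \<O>" if "x \<in> carrier G" for x
  proof (cases "\<chi> x = 0")
    case False
    have "\<bar>v (\<chi> x)\<bar> \<le> v q"
      unfolding q(2) using that finite_carrier by (intro member_le_sum) auto
    moreover have "v (q * \<chi> x) = v q + v (\<chi> x)"
      using valuation q(1) False by (simp add: discrete_valuation_def)
    ultimately show ?thesis unfolding \<O>_eq valuation_ring_def by simp linarith
  qed simp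
  have "r ^ k * (q * \<chi> w) \<in> \<O>" if "w \<in> carrier G" for k w
    using that
  proof (induction k arbitrary: w)
    case (Suc k)
    have "r ^ Suc k * (q * \<chi> w) = r ^ k * q * (r * \<chi> w)" by (simp add: mult_ac)
    also have "\<dots> = (\<Sum>i\<in>I. \<beta> i * (r ^ k * (q * \<chi> (w \<otimes> s i))))"
      by (simp add: r[OF Suc.prems] sum_distrib_left mult_ac)
    also have "\<dots> \<in> \<O>" using s \<beta> Suc by (intro \<O>_sum \<O>_closed(4)[OF \<beta>]) auto
    finally show ?case .
  qed (simp add: bounded)
  thus ?thesis
    using valuation_ring_completely_integrally_closed[OF valuation, of "q * \<chi> \<one>" r] q(1) degree_nonzero
    by (simp add: \<O>_eq)
qed

text \<open>Here \<open>\<chi>\<close> vanishes outside the subgroup \<open>Z\<close> of elements acting as scalars. So the form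
  \<open>X x \<mapsto> \<chi> x / \<chi> \<one>\<close> kills all cosets of \<open>Z\<close> except \<open>Z\<close> itself, and coset representatives are dual to
  their inverses.\<close>

theorem symmetric_if_commute_up_to_scalar:
  assumes comm: "\<And>u x. u \<in> carrier G \<Longrightarrow> x \<in> carrier G \<Longrightarrow> commute_up_to_scalar u x"
  shows "symmetric_algebra (coeff_ring \<O>) A"
proof -
  define Z where "Z = {z \<in> carrier G. scalar z}"
  have Z_iff: "z \<in> Z \<longleftrightarrow> z \<in> carrier G \<and> scalar z" for z by (simp add: Z_def)
  interpret Z: subgroup Z G unfolding Z_def by (rule subgroup_scalar)
  define rep where "rep = (\<lambda>x. SOME y. y \<in> carrier G \<and> x \<otimes> inv y \<in> Z)"
  define J where "J = rep ` carrier G"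
  have rep: "rep x \<in> carrier G" "x \<otimes> inv (rep x) \<in> Z" if "x \<in> carrier G" for x
  proof -
    have "x \<in> carrier G \<and> x \<otimes> inv x \<in> Z" using that Z.one_closed by simp
    from someI[of "\<lambda>y. y \<in> carrier G \<and> x \<otimes> inv y \<in> Z", OF this]
    show "rep x \<in> carrier G" "x \<otimes> inv (rep x) \<in> Z" by (simp_all add: rep_def)
  qed
  have rep_eq: "rep x = rep y" if xy: "x \<in> carrier G" "y \<in> carrier G" "x \<otimes> inv y \<in> Z" for x y
  proof -
    have "x \<otimes> inv a \<in> Z \<longleftrightarrow> y \<otimes> inv a \<in> Z" if a: "a \<in> carrier G" for a
    proof
      assume "y \<otimes> inv a \<in> Z"
      hence "(x \<otimes> inv y) \<otimes> (y \<otimes> inv a) \<in> Z" using xy by blast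
      thus "x \<otimes> inv a \<in> Z" using xy a by (simp add: m_assoc)
    next
      assume "x \<otimes> inv a \<in> Z"
      hence "inv (x \<otimes> inv y) \<otimes> (x \<otimes> inv a) \<in> Z" using xy by blast
      thus "y \<otimes> inv a \<in> Z" using xy a by (simp add: m_assoc inv_mult_group)
    qed
    thus ?thesis unfolding rep_def by (metis (no_types, lifting))
  qed
  have J_sub: "J \<subseteq> carrier G" using rep by (auto simp: J_def)
  have rep_unique: "j = rep x" if "j \<in> J" "x \<in> carrier G" "x \<otimes> inv j \<in> Z" for j x
  proof -
    obtain y where y: "y \<in> carrier G" "j = rep y" using \<open>j \<in> J\<close> by (auto simp: J_def)
    have jG: "j \<in> carrier G" using \<open>j \<in> J\<close> J_sub by blast
    have "(x \<otimes> inv j) \<otimes> inv (y \<otimes> inv j) \<in> Z" using that y rep by blast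
    moreover have "(x \<otimes> inv j) \<otimes> inv (y \<otimes> inv j) = x \<otimes> inv y"
      using that(2) y(1) jG by (simp add: inv_mult_group m_assoc)
    ultimately have "rep x = rep y" using rep_eq[of x y] that(2) y(1) by simp
    thus ?thesis using y(2) by simp
  qed
  define c where "c = 1 / \<chi> \<one>"
  have vanish: "\<chi> x = 0" if "x \<in> carrier G" "x \<notin> Z" for x
  proof (rule ccontr)
    assume "\<chi> x \<noteq> 0"
    hence "scalar x" by (rule scalar_if_nonzero[OF that(1)]) (rule comm[OF _ that(1)])
    thus False using that Z_iff by blast
  qed
  show ?thesis
  proof (rule symmetric_if_dual_family[OF J_sub, where c = c and \<beta> = "\<lambda>j y. if y = inv j then 1 else 0"])
    fix i j assume ij: "i \<in> J" "j \<in> J" and eq: "\<And>w. w \<in> carrier G \<Longrightarrow> \<chi> (w \<otimes> i) = \<chi> (w \<otimes> j)"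
    have G: "i \<in> carrier G" "j \<in> carrier G" using ij J_sub by auto
    have "\<chi> (x \<otimes> (i \<otimes> inv j)) = 1 * \<chi> x" if x: "x \<in> carrier G" for x
      using eq[of "inv j \<otimes> x"] G x class_function[of "inv j" "x \<otimes> i"] class_function[of "inv j" "x \<otimes> j"]
      by (simp add: m_assoc)
    hence "i \<otimes> inv j \<in> Z" using G unfolding Z_iff scalar_def by blast
    hence "j = rep i" using ij G by (intro rep_unique)
    moreover have "i \<otimes> inv i \<in> Z" using G Z.one_closed by simp
    hence "i = rep i" using ij G by (intro rep_unique)
    ultimately show "i = j" by (rule trans[OF _ sym, rotated])
  next
    fix x assume x: "x \<in> carrier G"
    show "c * \<chi> x \<in> \<O>"
    proof (cases "\<chi> x = 0")
      case False
      then obtain \<omega> where \<omega>: "\<And>w. w \<in> carrier G \<Longrightarrow> \<chi> (w \<otimes> x) = \<omega> * \<chi> w"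
        using vanish[OF x] Z_iff[of x] unfolding scalar_def by blast
      have "\<omega> \<in> \<O>" by (rule scalar_integral[of "{()}" "\<lambda>_. x" "\<lambda>_. 1"]) (use x \<omega> in auto)
      moreover have "c * \<chi> x = \<omega>" using \<omega>[of \<one>] x degree_nonzero by (simp add: c_def)
      ultimately show ?thesis by simp
    qed simp
  next
    fix w x assume w: "w \<in> carrier G" and x: "x \<in> carrier G"
    define j where "j = rep x"
    have j: "j \<in> J" "j \<in> carrier G" "x \<otimes> inv j \<in> Z" using x rep by (auto simp: j_def J_def)
    obtain \<omega> where \<omega>: "\<And>w. w \<in> carrier G \<Longrightarrow> \<chi> (w \<otimes> (x \<otimes> inv j)) = \<omega> * \<chi> w"
      using j(3) unfolding Z_iff scalar_def by blast
    have delta: "(\<Sum>y\<in>carrier G. (if y = inv i then 1 else 0) * \<chi> (y \<otimes> x)) = (if i = j then \<omega> * \<chi> \<one> else 0)"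
      if i: "i \<in> J" for i
    proof -
      have iG: "i \<in> carrier G" using i J_sub by blast
      have "(\<Sum>y\<in>carrier G. (if y = inv i then 1 else 0) * \<chi> (y \<otimes> x)) = \<chi> (inv i \<otimes> x)"
        using iG finite_carrier by (simp add: if_distrib[of "\<lambda>t. t * _"] cong: if_cong)
      also have "\<dots> = \<chi> (x \<otimes> inv i)" using class_function iG x by simp
      also have "\<dots> = (if i = j then \<omega> * \<chi> \<one> else 0)"
      proof (cases "i = j")
        case True
        thus ?thesis using \<omega>[of \<one>] x iG by simp
      next
        case False
        hence "x \<otimes> inv i \<notin> Z" using rep_unique[OF i x] by (auto simp: j_def)
        thus ?thesis using vanish[of "x \<otimes> inv i"] x iG False by simp
      qed
      finally show ?thesis .
    qed
    have "c * (\<Sum>i\<in>J. (\<Sum>y\<in>carrier G. (if y = inv i then 1 else 0) * \<chi> (y \<otimes> x)) * \<chi> (w \<otimes> i))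
        = c * (\<Sum>i\<in>J. if i = j then \<omega> * \<chi> \<one> * \<chi> (w \<otimes> j) else 0)"
      by (intro arg_cong[of _ _ "(*) c"] sum.cong) (auto simp: delta)
    also have "\<dots> = \<omega> * \<chi> (w \<otimes> j)"
      using j J_sub finite_carrier finite_subset[of J] degree_nonzero by (simp add: c_def)
    also have "\<dots> = \<chi> (w \<otimes> x)"
      using \<omega>[of "j \<otimes> w"] class_function[of j w] class_function[of j "w \<otimes> (x \<otimes> inv j)"] w x j
      by (simp add: m_assoc)
    finally show "\<chi> (w \<otimes> x)
        = c * (\<Sum>i\<in>J. (\<Sum>y\<in>carrier G. (if y = inv i then 1 else 0) * \<chi> (y \<otimes> x)) * \<chi> (w \<otimes> i))"
      by simp
  qed auto
qed

end

section \<open>Groups generated by a cyclic normal subgroup and one more element\<close>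

locale cyclic_extension_character = character_over_valuation_ring G \<chi> \<O> v
  for G (structure) and \<chi> :: "'a \<Rightarrow> 'k::field_char_0" and \<O> v +
  fixes g t :: 'a and d :: nat
  assumes g [simp]: "g \<in> carrier G" and t [simp]: "t \<in> carrier G"
    and generate: "subgroup H G \<Longrightarrow> g \<in> H \<Longrightarrow> t \<in> H \<Longrightarrow> H = carrier G"
    and conj_g: "t \<otimes> g \<otimes> inv t = g [^] Suc d"
begin

definition trivial_power :: "nat \<Rightarrow> bool" where
  "trivial_power i \<longleftrightarrow> (\<forall>x\<in>carrier G. \<chi> (x \<otimes> g [^] i) = \<chi> x)"

lemma trivial_power_mult: "trivial_power i \<Longrightarrow> trivial_power (i * j)"
proof (induction j)
  case (Suc j)
  have "\<chi> (x \<otimes> g [^] (i * Suc j)) = \<chi> x" if "x \<in> carrier G" for x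
  proof -
    have "\<chi> (x \<otimes> g [^] (i * Suc j)) = \<chi> (x \<otimes> g [^] i \<otimes> g [^] (i * j))"
      using that by (simp add: m_assoc nat_pow_mult)
    also have "\<dots> = \<chi> x" using Suc that by (simp add: trivial_power_def)
    finally show ?thesis .
  qed
  thus ?case by (simp add: trivial_power_def)
qed (simp add: trivial_power_def)

lemma conj_pow: "t \<otimes> g [^] (k :: nat) \<otimes> inv t = g [^] (Suc d * k)"
proof (induction k)
  case (Suc k)
  have "t \<otimes> g [^] Suc k \<otimes> inv t = (t \<otimes> g [^] k \<otimes> inv t) \<otimes> (t \<otimes> g \<otimes> inv t)"
    by (simp add: m_assoc)
  also have "\<dots> = g [^] (Suc d * k + Suc d)"
    by (simp only: Suc.IH conj_g nat_pow_mult[OF g])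
  finally show ?case by (simp add: add.commute)
qed simp

text \<open>Conjugation by \<open>t\<close> multiplies \<open>g ^ k\<close> by \<open>g ^ (d * k)\<close>; conjugation by \<open>g\<close> fixes it.\<close>

lemma conjugation_invariant_pow:
  assumes "trivial_power (d * k)" "x \<in> carrier G" "u \<in> carrier G"
  shows "\<chi> (x \<otimes> (u \<otimes> g [^] k \<otimes> inv u)) = \<chi> (x \<otimes> g [^] k)"
proof -
  let ?H = "{u \<in> carrier G. \<forall>x\<in>carrier G. \<chi> (x \<otimes> (u \<otimes> g [^] k \<otimes> inv u)) = \<chi> (x \<otimes> g [^] k)}"
  have "g \<otimes> g [^] k \<otimes> inv g = g [^] k"
    by (metis g inv_solve_right nat_pow_Suc nat_pow_Suc2 nat_pow_closed)
  moreover have "\<chi> (x \<otimes> (t \<otimes> g [^] k \<otimes> inv t)) = \<chi> (x \<otimes> g [^] k)" if "x \<in> carrier G" for x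
  proof -
    have "\<chi> (x \<otimes> (t \<otimes> g [^] k \<otimes> inv t)) = \<chi> ((x \<otimes> g [^] k) \<otimes> g [^] (d * k))"
      using that by (simp only: conj_pow) (simp add: m_assoc nat_pow_mult)
    also have "\<dots> = \<chi> (x \<otimes> g [^] k)" using assms(1) that by (simp add: trivial_power_def)
    finally show ?thesis .
  qed
  ultimately have "?H = carrier G"
    using subgroup_conjugation_invariant[of "g [^] k"] by (intro generate) auto
  thus ?thesis using assms(2,3) by blast
qed

text \<open>The assumption makes \<open>g ^ d\<close> act as a scalar, so \<open>t\<close> and \<open>g\<close> commute up to a scalar. The elements that
  commute with a given one up to a scalar form a subgroup, so this property spreads from the generators
  to the whole group.\<close>

theorem symmetric_if_trivial_power:
  assumes "trivial_power (d * d)"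
  shows "symmetric_algebra (coeff_ring \<O>) A"
proof (rule symmetric_if_commute_up_to_scalar)
  have "scalar (g [^] d)"
    using conjugation_invariant_pow[OF assms] by (intro conjugation_invariant_scalar) auto
  then obtain \<omega> where \<omega>: "\<And>x. x \<in> carrier G \<Longrightarrow> \<chi> (x \<otimes> g [^] d) = \<omega> * \<chi> x"
    by (auto simp: scalar_def)
  have "\<omega> \<noteq> 0" using \<omega>[of "inv (g [^] d)"] degree_nonzero by auto
  moreover have "\<chi> (w \<otimes> (t \<otimes> g)) = \<omega> * \<chi> (w \<otimes> (g \<otimes> t))" if w: "w \<in> carrier G" for w
  proof -
    have "t \<otimes> g = g [^] Suc d \<otimes> t" using inv_solve_right[of "t \<otimes> g" "g [^] Suc d" t] conj_g
      by (metis g inv_solve_right' m_closed nat_pow_closed t)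
    hence "\<chi> (w \<otimes> (t \<otimes> g)) = \<chi> (w \<otimes> (g \<otimes> (g [^] d \<otimes> t)))"
      using w by (simp only: nat_pow_Suc2[OF g]) (simp add: m_assoc)
    also have "\<dots> = \<chi> (t \<otimes> w \<otimes> g \<otimes> g [^] d)"
      using class_function[of t "w \<otimes> (g \<otimes> g [^] d)"] w by (simp add: m_assoc)
    also have "\<dots> = \<omega> * \<chi> (w \<otimes> (g \<otimes> t))"
      using \<omega>[of "t \<otimes> w \<otimes> g"] class_function[of t "w \<otimes> g"] w by (simp add: m_assoc)
    finally show ?thesis .
  qed
  ultimately have tg: "commute_up_to_scalar t g" unfolding commute_up_to_scalar_def by blast
  have refl: "commute_up_to_scalar x x" for x
    unfolding commute_up_to_scalar_def by (intro exI[of _ 1]) simp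
  have all: "commute_up_to_scalar u x"
    if "x \<in> carrier G" "commute_up_to_scalar g x" "commute_up_to_scalar t x" "u \<in> carrier G" for u x
    using generate[OF subgroup_commute_up_to_scalar[OF that(1)]] that by auto
  have "commute_up_to_scalar g u" "commute_up_to_scalar t u" if "u \<in> carrier G" for u
    using all[of g u] all[of t u] refl tg that by (auto intro: commute_up_to_scalar_sym)
  thus "commute_up_to_scalar u x" if "u \<in> carrier G" "x \<in> carrier G" for u x
    using all that by blast
qed

end

text \<open>The situation of dihedral, semidihedral and quaternion groups: \<open>C\<close> is generated by \<open>g\<close> and has
  index two, and conjugation by \<open>t\<close> raises \<open>g\<close> to a power \<open>k \<equiv> 3 (mod 4)\<close>. The last assumption
  excludes the characters covered by \<open>symmetric_if_trivial_power\<close>.\<close>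

locale index_two_character = cyclic_extension_character G \<chi> \<O> v g t d
  for G (structure) and \<chi> :: "'a \<Rightarrow> 'k::field_char_0" and \<O> v and g t :: 'a and d :: nat +
  fixes C :: "'a set" and b n :: nat
  assumes subgroup_C: "subgroup C G" and C_eq: "C = range (\<lambda>i::nat. g [^] i)"
    and t_notin: "t \<notin> C" and cover: "x \<in> carrier G \<Longrightarrow> x \<notin> C \<Longrightarrow> x \<otimes> inv t \<in> C"
    and d_eq: "d = 2 * b" and odd_b: "odd b" and order_g: "g [^] (2 ^ n :: nat) = \<one>"
    and nontrivial: "\<not> trivial_power 4"
begin

sublocale C: subgroup C G by (rule subgroup_C)

lemma pow_C [simp]: "g [^] (i::nat) \<in> C"
  by (auto simp: C_eq)

lemma C_E: assumes "x \<in> C" obtains i :: nat where "x = g [^] i"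
  using assms by (auto simp: C_eq)

lemma pow_commute: "g [^] (i::nat) \<otimes> g [^] (j::nat) = g [^] j \<otimes> g [^] i"
  by (simp add: nat_pow_mult add.commute)

lemma notin_C:
  assumes "c \<in> C" "x \<in> carrier G" "x \<notin> C"
  shows "c \<otimes> x \<notin> C" "x \<otimes> c \<notin> C"
proof -
  have c: "c \<in> carrier G" using assms(1) by (rule C.mem_carrier)
  show "c \<otimes> x \<notin> C"
  proof
    assume "c \<otimes> x \<in> C"
    hence "inv c \<otimes> (c \<otimes> x) \<in> C" using assms by blast
    thus False using assms c by simp
  qed
  show "x \<otimes> c \<notin> C"
  proof
    assume "x \<otimes> c \<in> C"
    hence "(x \<otimes> c) \<otimes> inv c \<in> C" using assms by blast
    thus False using assms c by (simp add: m_assoc)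
  qed
qed

lemma off_C_E:
  assumes "x \<in> carrier G" "x \<notin> C"
  obtains i :: nat where "x = g [^] i \<otimes> t"
proof -
  obtain i :: nat where "x \<otimes> inv t = g [^] i" using cover[OF assms] by (rule C_E)
  hence "x = g [^] i \<otimes> t" using assms by (metis inv_solve_right' nat_pow_closed g t)
  thus thesis by (rule that)
qed

lemma conj_pow_twice: "g [^] (Suc d * (Suc d * k)) = g [^] k" for k :: nat
proof -
  have "t \<otimes> t \<in> C"
  proof (rule ccontr)
    assume "t \<otimes> t \<notin> C"
    hence "t \<otimes> t \<otimes> inv t \<in> C" by (intro cover) auto
    thus False using t_notin by (simp add: m_assoc)
  qed
  then obtain i :: nat where i: "t \<otimes> t = g [^] i" by (rule C_E)
  have "g [^] (Suc d * (Suc d * k)) = t \<otimes> (t \<otimes> g [^] k \<otimes> inv t) \<otimes> inv t"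
    by (simp only: conj_pow)
  also have "\<dots> = (t \<otimes> t) \<otimes> g [^] k \<otimes> inv (t \<otimes> t)"
    by (simp add: m_assoc inv_mult_group)
  also have "\<dots> = g [^] k \<otimes> g [^] i \<otimes> inv (g [^] i)"
    unfolding i by (simp only: pow_commute)
  also have "\<dots> = g [^] k" by (simp add: m_assoc)
  finally show ?thesis .
qed

text \<open>Since \<open>t\<^sup>2 \<in> C\<close>, conjugation by \<open>t\<close> exchanges \<open>g\<close> and \<open>g ^ (d + 1)\<close>, and \<open>g ^ d\<close> is their quotient.\<close>

lemma conj_inverse: "t \<otimes> g [^] (d * k) \<otimes> inv t = inv (g [^] (d * k))" for k :: nat
proof -
  have "g [^] (Suc d * (d * k)) \<otimes> g [^] (d * k) \<otimes> g [^] k = g [^] (Suc d * (Suc d * k))"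
    by (simp add: nat_pow_mult algebra_simps)
  also have "\<dots> = \<one> \<otimes> g [^] k" by (simp only: conj_pow_twice) simp
  finally have "g [^] (Suc d * (d * k)) \<otimes> g [^] (d * k) = \<one>"
    by (simp only: r_cancel_one[symmetric] right_cancel nat_pow_closed[OF g] m_closed one_closed)
  thus ?thesis unfolding conj_pow by (metis g inv_equality nat_pow_closed)
qed

lemma conj_cases:
  assumes "u \<in> carrier G"
  shows "(\<forall>k::nat. u \<otimes> g [^] k \<otimes> inv u = g [^] k) \<or> (\<forall>k::nat. u \<otimes> g [^] k \<otimes> inv u = g [^] (Suc d * k))"
proof (cases "u \<in> C")
  case True
  then obtain i :: nat where u: "u = g [^] i" by (rule C_E)
  have "u \<otimes> g [^] k \<otimes> inv u = g [^] k" for k :: nat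
    unfolding u pow_commute[of i k] by (simp add: m_assoc)
  thus ?thesis by blast
next
  case False
  then obtain i :: nat where u: "u = g [^] i \<otimes> t" using off_C_E assms by blast
  have "u \<otimes> g [^] k \<otimes> inv u = g [^] (Suc d * k)" for k :: nat
  proof -
    have "u \<otimes> g [^] k \<otimes> inv u = g [^] i \<otimes> (t \<otimes> g [^] k \<otimes> inv t) \<otimes> inv (g [^] i)"
      unfolding u by (simp add: inv_mult_group m_assoc)
    also have "\<dots> = g [^] (Suc d * k) \<otimes> g [^] i \<otimes> inv (g [^] i)"
      by (simp only: conj_pow pow_commute)
    finally show ?thesis by (simp add: m_assoc)
  qed
  thus ?thesis by blast
qed

text \<open>Let \<open>2 ^ m\<close> be the least power of two for which \<open>g ^ (2 ^ m)\<close> acts trivially; here \<open>m \<ge> 3\<close>. Then \<open>g ^ (2 ^ (m - 1))\<close>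
  acts as a scalar whose square is \<open>1\<close> and which is not \<open>1\<close>. For \<open>r = 2 ^ (m - 2)\<close> the exponent \<open>d * r\<close> is an odd
  multiple of \<open>2 ^ (m - 1)\<close>, and \<open>r\<close> is even because \<open>m \<ge> 3\<close>.\<close>

lemma minus_one_power: "\<exists>r. even r \<and> 0 < r \<and> (\<forall>x\<in>carrier G. \<chi> (x \<otimes> g [^] (d * r)) = - \<chi> x)"
proof -
  have "trivial_power (2 ^ n)" using order_g by (simp add: trivial_power_def)
  define m where "m = (LEAST m. trivial_power (2 ^ m))"
  have triv: "trivial_power (2 ^ m)" unfolding m_def by (rule LeastI, fact)
  have "3 \<le> m"
  proof (rule ccontr)
    assume "\<not> 3 \<le> m"
    hence "m \<in> {0, 1, 2}" by auto
    hence "\<exists>j. 4 = (2 ^ m) * (j::nat)" by auto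
    then obtain j :: nat where "4 = 2 ^ m * j" by blast
    thus False using trivial_power_mult[OF triv, of j] nontrivial by simp
  qed
  define r where "r = (2::nat) ^ (m - 2)"
  have m_eq: "m = Suc (Suc (m - 2))" using \<open>3 \<le> m\<close> by simp
  have q: "2 ^ m = 2 * (2 * r)" "2 ^ (m - 1) = 2 * r"
    using m_eq by (metis power_Suc r_def, metis diff_Suc_1 power_Suc r_def)
  have nontriv: "\<not> trivial_power (2 * r)"
  proof -
    have "m - 1 < m" using \<open>3 \<le> m\<close> by simp
    hence "\<not> trivial_power (2 ^ (m - 1))" unfolding m_def by (rule not_less_Least)
    thus ?thesis unfolding q .
  qed
  have "trivial_power (d * (2 * r))"
    using trivial_power_mult[OF triv, of b] by (simp add: q d_eq mult_ac)
  hence "scalar (g [^] (2 * r))"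
    using conjugation_invariant_pow by (intro conjugation_invariant_scalar) auto
  then obtain \<omega> where \<omega>: "\<And>x. x \<in> carrier G \<Longrightarrow> \<chi> (x \<otimes> g [^] (2 * r)) = \<omega> * \<chi> x"
    by (auto simp: scalar_def)
  have "\<omega> * (\<omega> * \<chi> \<one>) = \<chi> (g [^] (2 * r) \<otimes> g [^] (2 * r))"
    using \<omega>[of "g [^] (2 * r)"] \<omega>[of \<one>] by simp
  also have "\<dots> = \<chi> (\<one> \<otimes> g [^] ((2::nat) ^ m))" by (simp add: nat_pow_mult q)
  also have "\<dots> = \<chi> \<one>" using triv one_closed unfolding trivial_power_def by blast
  finally have "\<omega> * \<omega> = 1" using degree_nonzero by simp
  moreover have "\<omega> \<noteq> 1" using nontriv \<omega> by (auto simp: trivial_power_def)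
  ultimately have "\<omega> = - 1" using square_eq_1_iff by blast
  have "\<chi> (x \<otimes> g [^] (2 * r * j)) = (- 1) ^ j * \<chi> x" if "x \<in> carrier G" for x and j :: nat
  proof (induction j)
    case (Suc j)
    have "\<chi> (x \<otimes> g [^] (2 * r * Suc j)) = \<chi> (x \<otimes> g [^] (2 * r * j) \<otimes> g [^] (2 * r))"
      using that by (simp add: m_assoc nat_pow_mult add.commute)
    thus ?case using \<omega>[of "x \<otimes> g [^] (2 * r * j)"] that Suc \<open>\<omega> = - 1\<close> by simp
  qed (use that in simp)
  from this[where j = b] have "\<forall>x\<in>carrier G. \<chi> (x \<otimes> g [^] (d * r)) = - \<chi> x"
    using odd_b by (simp add: d_eq mult_ac)
  moreover have "even r" "0 < r" using \<open>3 \<le> m\<close> by (simp_all add: r_def)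
  ultimately show ?thesis by blast
qed

lemma trace_scalar: "\<exists>T. \<forall>x\<in>carrier G. \<chi> (x \<otimes> g) + \<chi> (x \<otimes> g [^] Suc d) = T * \<chi> x"
proof -
  have "\<exists>T. \<forall>x\<in>carrier G. (\<Sum>i\<in>(UNIV::bool set). \<chi> (x \<otimes> (if i then g else g [^] Suc d))) = T * \<chi> x"
  proof (rule conjugation_invariant_sum_scalar)
    fix x u assume "x \<in> carrier G" and u: "u \<in> carrier G"
    have pow_one: "g [^] (1::nat) = g" by simp
    have "u \<otimes> g \<otimes> inv u = g \<and> u \<otimes> g [^] Suc d \<otimes> inv u = g [^] Suc d \<or>
        u \<otimes> g \<otimes> inv u = g [^] Suc d \<and> u \<otimes> g [^] Suc d \<otimes> inv u = g"
      using conj_cases[OF u] conj_pow_twice[of 1] pow_one by (metis mult.right_neutral)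
    thus "(\<Sum>i\<in>(UNIV::bool set). \<chi> (x \<otimes> (u \<otimes> (if i then g else g [^] Suc d) \<otimes> inv u)))
        = (\<Sum>i\<in>(UNIV::bool set). \<chi> (x \<otimes> (if i then g else g [^] Suc d)))"
      by (auto simp: UNIV_bool add.commute simp del: nat_pow_Suc)
  qed (auto simp del: nat_pow_Suc)
  thus ?thesis by (simp add: UNIV_bool add.commute del: nat_pow_Suc)
qed

lemma norm_scalar: "scalar (g [^] (d + 2))"
proof (rule conjugation_invariant_scalar)
  fix x u assume "x \<in> carrier G" and u: "u \<in> carrier G"
  have "g [^] (Suc d * (d + 2)) = g [^] (Suc d * (Suc d * 1)) \<otimes> g [^] Suc d"
    by (simp only: nat_pow_mult[OF g]) (rule arg_cong[where f = "\<lambda>k. g [^] k"], simp add: algebra_simps)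
  also have "\<dots> = g [^] (d + 2)"
    by (simp only: conj_pow_twice nat_pow_mult[OF g]) simp
  finally show "\<chi> (x \<otimes> (u \<otimes> g [^] (d + 2) \<otimes> inv u)) = \<chi> (x \<otimes> g [^] (d + 2))"
    using conj_cases[OF u] by metis
qed simp

text \<open>Notation: \<open>g'\<close> is the conjugate of \<open>g\<close>, and \<open>h = g ^ d\<close> is \<open>g' g\<inverse>\<close>. The scalars are \<open>T = g + g'\<close> and
  \<open>N = g g'\<close>, so that \<open>g\<^sup>2 = T g - N\<close>; and \<open>h\<^sup>r\<close> acts as \<open>-1\<close>. All these identities are meant in the component
  of \<open>\<chi>\<close>, as relations between character values.\<close>

theorem symmetric_index_two: "symmetric_algebra (coeff_ring \<O>) A"
proof -
  define g' where "g' = g [^] Suc d"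
  have g'_carrier [simp]: "g' \<in> carrier G" and g'_C [simp]: "g' \<in> C"
    unfolding g'_def by (simp_all only: nat_pow_closed[OF g] pow_C)
  have g'_commute: "g [^] k \<otimes> g' = g' \<otimes> g [^] k" for k :: nat
    unfolding g'_def by (rule pow_commute)
  have d2: "d + 2 = Suc (Suc d)" by simp
  have g_g': "g \<otimes> g' = g [^] (d + 2)" and g'_g: "g' \<otimes> g = g [^] (d + 2)"
    unfolding g'_def d2 by (simp only: nat_pow_Suc2[OF g], simp only: nat_pow_Suc)
  have conj_g': "t \<otimes> g \<otimes> inv t = g'" unfolding g'_def by (rule conj_g)
  obtain r where r: "even r" "0 < r" and neg: "\<And>x. x \<in> carrier G \<Longrightarrow> \<chi> (x \<otimes> g [^] (d * r)) = - \<chi> x"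
    using minus_one_power by blast
  obtain T where T: "\<And>x. x \<in> carrier G \<Longrightarrow> \<chi> (x \<otimes> g) + \<chi> (x \<otimes> g') = T * \<chi> x"
    using trace_scalar unfolding g'_def by blast
  obtain N where N: "\<And>x. x \<in> carrier G \<Longrightarrow> \<chi> (x \<otimes> g [^] (d + 2)) = N * \<chi> x"
    using norm_scalar by (auto simp: scalar_def)
  have T_int: "T \<in> \<O>"
  proof (rule scalar_integral[of "UNIV :: bool set" "\<lambda>i. if i then g else g'" "\<lambda>_. 1"])
    show "T * \<chi> w = (\<Sum>i\<in>UNIV. 1 * \<chi> (w \<otimes> (if i then g else g')))" if "w \<in> carrier G" for w
      using T[OF that] by (simp add: UNIV_bool add.commute)
  qed (auto)
  have N_int: "N \<in> \<O>"
    by (rule scalar_integral[of "{()}" "\<lambda>_. g [^] (d + 2)" "\<lambda>_. 1"]) (use N in \<open>auto\<close>)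
  \<comment> \<open>As \<open>g + g' = T\<close>, the right-hand side telescopes: this is \<open>2 g = T (1 - h + h\<^sup>2 - \<dots>)\<close>. It shows both that
    \<open>T \<noteq> 0\<close> and that \<open>2 / T\<close> is integral.\<close>
  have twice: "2 * \<chi> w = T * (\<Sum>j<r. (- 1) ^ j * \<chi> (w \<otimes> (inv g \<otimes> g [^] (d * j))))"
    if w: "w \<in> carrier G" for w
  proof -
    define F where "F = (\<lambda>j::nat. \<chi> (w \<otimes> g [^] (d * j)))"
    have step: "T * \<chi> (w \<otimes> (inv g \<otimes> g [^] (d * j))) = F j + F (Suc j)" for j
    proof -
      have "w \<otimes> (inv g \<otimes> g [^] (d * j)) \<otimes> g = w \<otimes> (inv g \<otimes> (g \<otimes> g [^] (d * j)))"
        using w nat_pow_Suc2[OF g, of "d * j"] nat_pow_Suc[of g "d * j"] by (simp add: m_assoc)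
      moreover have "w \<otimes> (inv g \<otimes> g [^] (d * j)) \<otimes> g' = w \<otimes> (inv g \<otimes> (g \<otimes> g [^] (d * Suc j)))"
      proof -
        have "g [^] (d * j) \<otimes> g' = g \<otimes> g [^] (d * Suc j)"
          unfolding g'_def
          by (simp only: nat_pow_mult[OF g] nat_pow_Suc2[OF g, symmetric]) (simp add: algebra_simps)
        thus ?thesis using w by (simp add: m_assoc)
      qed
      ultimately show ?thesis
        using T[of "w \<otimes> (inv g \<otimes> g [^] (d * j))"] w by (simp add: F_def)
    qed
    have "T * (\<Sum>j<r. (- 1) ^ j * \<chi> (w \<otimes> (inv g \<otimes> g [^] (d * j)))) = (\<Sum>j<r. (- 1) ^ j * (F j + F (Suc j)))"
      unfolding step[symmetric] sum_distrib_left by (simp add: mult_ac)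
    also have "\<dots> = (\<Sum>j<r. - ((- 1) ^ Suc j * F (Suc j)) - - ((- 1) ^ j * F j) + 2 * ((- 1) ^ Suc j * F (Suc j) + (- 1) ^ j * F (Suc j)))"
      by (intro sum.cong) (auto simp: algebra_simps)
    also have "\<dots> = (\<Sum>j<r. - ((- 1) ^ Suc j * F (Suc j)) - - ((- 1) ^ j * F j))"
      by (intro sum.cong) auto
    also have "\<dots> = - ((- 1) ^ r * F r) - - ((- 1) ^ 0 * F 0)"
      by (rule sum_lessThan_telescope)
    also have "\<dots> = 2 * \<chi> w" using r neg w by (simp add: F_def)
    finally show ?thesis by simp
  qed
  have T_nz: "T \<noteq> 0" using twice[of \<one>] degree_nonzero by auto
  have T_inv_int: "2 / T \<in> \<O>"
  proof (rule scalar_integral[of "{..<r}" "\<lambda>j. inv g \<otimes> g [^] (d * j)" "\<lambda>j. (- 1) ^ j"])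
    show "2 / T * \<chi> w = (\<Sum>j<r. (- 1) ^ j * \<chi> (w \<otimes> (inv g \<otimes> g [^] (d * j))))" if "w \<in> carrier G" for w
      using twice[OF that] T_nz by (simp add: field_simps)
  qed (auto intro!: \<O>_power)
  \<comment> \<open>\<open>V x\<close> is the character at \<open>x v\<close> for \<open>v = h + \<dots> + h\<^sup>r\<^sup>-\<^sup>1\<close>, and \<open>V_diff\<close> is the relation \<open>(g - g') v = T\<close>.\<close>
  define V where "V = (\<lambda>x. \<Sum>j\<in>{1..<r}. \<chi> (x \<otimes> g [^] (d * j)))"
  have V_diff: "V (x \<otimes> g) - V (x \<otimes> g') = T * \<chi> x" if x: "x \<in> carrier G" for x
  proof -
    define F where "F = (\<lambda>j::nat. \<chi> (x \<otimes> g \<otimes> g [^] (d * j)))"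
    have "\<chi> (x \<otimes> g' \<otimes> g [^] (d * j)) = F (Suc j)" for j
    proof -
      have "g' \<otimes> g [^] (d * j) = g \<otimes> g [^] (d * Suc j)"
        unfolding g'_def by (simp only: nat_pow_mult[OF g] nat_pow_Suc2[OF g, symmetric]) simp
      thus ?thesis using x by (simp add: F_def m_assoc)
    qed
    hence "V (x \<otimes> g) - V (x \<otimes> g') = - (\<Sum>j\<in>{1..<r}. F (Suc j) - F j)"
      by (simp add: V_def F_def sum_subtractf)
    also have "(\<Sum>j\<in>{1..<r}. F (Suc j) - F j) = F r - F 1"
      using r by (intro sum_Suc_diff') simp
    also have "F r = - \<chi> (x \<otimes> g)" using neg[of "x \<otimes> g"] x by (simp add: F_def)
    also have "F 1 = \<chi> (x \<otimes> g')"
      using x unfolding g'_def nat_pow_Suc2[OF g] by (simp add: F_def m_assoc)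
    finally show ?thesis using T[OF x] by (simp add: add.commute)
  qed
  \<comment> \<open>Outside \<open>C\<close> one has \<open>x g = g' x\<close>, so \<open>V (x g) = V (x g')\<close>, and \<open>V_diff\<close> forces \<open>\<chi> x = 0\<close>.\<close>
  have off_C: "\<chi> x = 0" if x: "x \<in> carrier G" "x \<notin> C" for x
  proof -
    obtain i :: nat where i: "x = g [^] i \<otimes> t" using off_C_E[OF x] .
    have xg: "x \<otimes> g = g' \<otimes> x"
    proof -
      have "t \<otimes> g = g' \<otimes> t"
        using conj_g' by (metis g g'_carrier inv_solve_right' m_closed t)
      hence "x \<otimes> g = (g [^] i \<otimes> g') \<otimes> t" by (simp add: i m_assoc)
      also have "\<dots> = (g' \<otimes> g [^] i) \<otimes> t" by (simp only: g'_commute)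
      finally show ?thesis by (simp add: i m_assoc)
    qed
    have "\<chi> (x \<otimes> g \<otimes> g [^] k) = \<chi> (x \<otimes> g' \<otimes> g [^] k)" for k :: nat
    proof -
      have "\<chi> (x \<otimes> g \<otimes> g [^] k) = \<chi> (g' \<otimes> (x \<otimes> g [^] k))"
        using x unfolding xg by (simp add: m_assoc)
      also have "\<dots> = \<chi> (x \<otimes> g [^] k \<otimes> g')"
        using x by (intro class_function) auto
      also have "\<dots> = \<chi> (x \<otimes> g' \<otimes> g [^] k)"
        by (simp only: m_assoc[OF x(1) nat_pow_closed[OF g] g'_carrier] m_assoc[OF x(1) g'_carrier nat_pow_closed[OF g]] g'_commute[of k])
      finally show ?thesis .
    qed
    hence "V (x \<otimes> g) = V (x \<otimes> g')" by (simp add: V_def)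
    thus ?thesis using V_diff[OF x(1)] T_nz by simp
  qed
  \<comment> \<open>Conjugation by \<open>t\<close> inverts \<open>h\<close>, and \<open>h\<^sup>-\<^sup>j = - h\<^sup>r\<^sup>-\<^sup>j\<close>; hence it maps \<open>v\<close> to \<open>- v\<close>.\<close>
  have V_conj: "V x = - V (t \<otimes> x \<otimes> inv t)" if x: "x \<in> carrier G" for x
  proof -
    have "\<chi> (x \<otimes> g [^] (d * j)) = - \<chi> (t \<otimes> x \<otimes> inv t \<otimes> g [^] (d * (r - j)))" if j: "j \<in> {1..<r}" for j
    proof -
      have "\<chi> (x \<otimes> g [^] (d * j)) = \<chi> (t \<otimes> x \<otimes> inv t \<otimes> (t \<otimes> g [^] (d * j) \<otimes> inv t))"
        using class_function[of t "x \<otimes> g [^] (d * j) \<otimes> inv t"] x by (simp add: m_assoc)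
      also have "\<dots> = \<chi> (t \<otimes> x \<otimes> inv t \<otimes> inv (g [^] (d * j)))"
        by (simp only: conj_inverse)
      also have "\<dots> = - \<chi> (t \<otimes> x \<otimes> inv t \<otimes> inv (g [^] (d * j)) \<otimes> g [^] (d * r))"
        using x by (simp add: neg)
      also have "g [^] (d * r) = g [^] (d * j) \<otimes> g [^] (d * (r - j))"
        using j by (simp add: nat_pow_mult flip: distrib_left)
      finally show ?thesis using x by (simp add: m_assoc)
    qed
    hence "V x = - (\<Sum>j\<in>{1..<r}. \<chi> (t \<otimes> x \<otimes> inv t \<otimes> g [^] (d * (r - j))))"
      by (simp add: V_def sum_negf)
    also have "(\<Sum>j\<in>{1..<r}. \<chi> (t \<otimes> x \<otimes> inv t \<otimes> g [^] (d * (r - j)))) = V (t \<otimes> x \<otimes> inv t)"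
      unfolding V_def by (rule sum.reindex_bij_witness[of _ "\<lambda>j. r - j" "\<lambda>j. r - j"]) auto
    finally show ?thesis .
  qed
  have V_one: "V \<one> = 0"
    using V_conj[of \<one>] by (simp add: eq_neg_iff_add_eq_0 flip: mult_2)
  have V_g': "V g' = - V g"
    using V_conj[OF g] by (simp only: conj_g') simp
  \<comment> \<open>With this constant the form takes the value \<open>1\<close> at \<open>g v\<close>, and it takes the value \<open>0\<close> at \<open>v\<close>.\<close>
  define c where "c = 2 / (T * \<chi> \<one>)"
  have c_V_g: "c * V g = 1"
    using V_diff[of \<one>] T_nz degree_nonzero by (simp add: V_g' c_def field_simps)
  \<comment> \<open>The image of \<open>\<O>C\<close> is spanned by \<open>1\<close> and \<open>g\<close>, because \<open>g\<^sup>2 = T g - N\<close>.\<close>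
  have expand: "\<exists>\<alpha>\<in>\<O>. \<exists>\<beta>\<in>\<O>. \<forall>x\<in>carrier G. \<chi> (x \<otimes> g [^] i) = \<alpha> * \<chi> x + \<beta> * \<chi> (x \<otimes> g)" for i :: nat
  proof (induction i)
    case 0
    show ?case by (intro bexI[of _ 1] bexI[of _ 0]) auto
  next
    case (Suc i)
    then obtain \<alpha> \<beta> where ab: "\<alpha> \<in> \<O>" "\<beta> \<in> \<O>"
      and eq: "\<And>x. x \<in> carrier G \<Longrightarrow> \<chi> (x \<otimes> g [^] i) = \<alpha> * \<chi> x + \<beta> * \<chi> (x \<otimes> g)" by blast
    have "\<chi> (x \<otimes> g [^] Suc i) = - (\<beta> * N) * \<chi> x + (\<alpha> + \<beta> * T) * \<chi> (x \<otimes> g)" if x: "x \<in> carrier G" for x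
    proof -
      have "\<chi> (x \<otimes> g [^] Suc i) = \<alpha> * \<chi> (x \<otimes> g) + \<beta> * \<chi> (x \<otimes> g \<otimes> g)"
        using eq[of "x \<otimes> g"] x by (simp add: m_assoc nat_pow_Suc2[OF g, symmetric])
      moreover have "\<chi> (x \<otimes> g \<otimes> g) = T * \<chi> (x \<otimes> g) - N * \<chi> x"
      proof -
        have "x \<otimes> g \<otimes> g' = x \<otimes> g [^] (d + 2)"
          using m_assoc[OF x g g'_carrier] by (simp only: g_g')
        thus ?thesis using T[of "x \<otimes> g"] N[OF x] x by (simp add: algebra_simps)
      qed
      ultimately show ?thesis by (simp add: algebra_simps)
    qed
    thus ?case using ab T_int N_int by (intro bexI[of _ "- (\<beta> * N)"] bexI[of _ "\<alpha> + \<beta> * T"]) auto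
  qed
  have \<chi>_g: "2 * \<chi> g = T * \<chi> \<one>"
  proof -
    have "\<chi> g' = \<chi> g"
      unfolding conj_g'[symmetric] using class_function[of t "g \<otimes> inv t"] by (simp add: m_assoc)
    thus ?thesis using T[of \<one>] by simp
  qed
  have V_expand: "V (g [^] k \<otimes> g [^] i) = \<alpha> * V (g [^] k) + \<beta> * V (g [^] k \<otimes> g)"
    if eq: "\<forall>x\<in>carrier G. \<chi> (x \<otimes> g [^] i) = \<alpha> * \<chi> x + \<beta> * \<chi> (x \<otimes> g)" for k i :: nat and \<alpha> \<beta>
  proof -
    have "\<chi> (g [^] k \<otimes> g [^] i \<otimes> g [^] (d * j)) = \<alpha> * \<chi> (g [^] k \<otimes> g [^] (d * j)) + \<beta> * \<chi> (g [^] k \<otimes> g \<otimes> g [^] (d * j))"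
      for j
    proof -
      have "g [^] k \<otimes> g [^] i \<otimes> g [^] (d * j) = g [^] k \<otimes> g [^] (d * j) \<otimes> g [^] i"
        by (simp add: m_assoc pow_commute[of i])
      moreover have "g [^] k \<otimes> g \<otimes> g [^] (d * j) = g [^] k \<otimes> g [^] (d * j) \<otimes> g"
        using pow_commute[of 1 "d * j"] by (simp add: m_assoc)
      ultimately show ?thesis using eq by simp
    qed
    thus ?thesis by (simp add: V_def sum.distrib sum_distrib_left)
  qed
  have V_norm: "V (g' \<otimes> g) = 0"
  proof -
    have "V (g [^] (d + 2)) = N * V \<one>"
    proof -
      have "\<chi> (g [^] (d + 2) \<otimes> g [^] (d * j)) = N * \<chi> (\<one> \<otimes> g [^] (d * j))" for j
        using N[of "g [^] (d * j)"] by (simp only: pow_commute[of "d + 2"]) simp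
      thus ?thesis by (simp add: V_def sum_distrib_left)
    qed
    thus ?thesis using V_one by (simp only: g'_g) simp
  qed
  \<comment> \<open>Duality inside \<open>\<O>C\<close>: \<open>1, g\<close> has the dual basis \<open>-g' v, v\<close>.\<close>
  have recover: "\<chi> (w \<otimes> g [^] i) = c * (- V (g' \<otimes> g [^] i) * \<chi> w + V (g [^] i) * \<chi> (w \<otimes> g))"
    if w: "w \<in> carrier G" for w and i :: nat
  proof -
    obtain \<alpha> \<beta> where eq: "\<forall>x\<in>carrier G. \<chi> (x \<otimes> g [^] i) = \<alpha> * \<chi> x + \<beta> * \<chi> (x \<otimes> g)"
      using expand[of i] by blast
    have "V (g [^] i) = \<beta> * V g" using V_expand[OF eq, of 0] V_one by simp
    moreover have "V (g' \<otimes> g [^] i) = - \<alpha> * V g"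
      using V_expand[OF eq, of "Suc d"] by (simp only: g'_def[symmetric] V_norm V_g') simp
    ultimately have "c * (- V (g' \<otimes> g [^] i) * \<chi> w + V (g [^] i) * \<chi> (w \<otimes> g))
        = (c * V g) * (\<alpha> * \<chi> w + \<beta> * \<chi> (w \<otimes> g))"
      by (simp only:) (simp add: algebra_simps)
    thus ?thesis using eq w c_V_g by simp
  qed
  have c_int: "c * \<chi> x \<in> \<O>" if x: "x \<in> carrier G" for x
  proof (cases "x \<in> C")
    case True
    then obtain i :: nat where i: "x = g [^] i" by (rule C_E)
    obtain \<alpha> \<beta> where ab: "\<alpha> \<in> \<O>" "\<beta> \<in> \<O>"
      and eq: "\<chi> (\<one> \<otimes> g [^] i) = \<alpha> * \<chi> \<one> + \<beta> * \<chi> (\<one> \<otimes> g)" using expand[of i] by blast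
    have "c * \<chi> x = \<alpha> * (2 / T) + \<beta>"
      using eq \<chi>_g T_nz degree_nonzero by (simp add: i c_def field_simps)
    moreover have "\<alpha> * (2 / T) + \<beta> \<in> \<O>"
      by (rule \<O>_closed(3)[OF \<O>_closed(4)]) (use ab T_inv_int in auto)
    ultimately show ?thesis by simp
  qed (use off_C x in auto)
  \<comment> \<open>\<open>S a x\<close> is the character at \<open>a v x\<close>, and \<open>\<delta> a\<close> is the element \<open>a v\<close> of \<open>\<O>P\<close>.\<close>
  define S where "S = (\<lambda>a x. \<Sum>j\<in>{1..<r}. \<chi> (a \<otimes> g [^] (d * j) \<otimes> x))"
  define \<delta> where "\<delta> = (\<lambda>a y. \<Sum>j\<in>{1..<r}. if y = a \<otimes> g [^] (d * j) then 1 else (0::'k))"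
  have \<delta>_S: "(\<Sum>y\<in>carrier G. \<delta> a y * \<chi> (y \<otimes> x)) = S a x" if "a \<in> carrier G" for a x
  proof -
    have "(\<Sum>y\<in>carrier G. \<delta> a y * \<chi> (y \<otimes> x))
        = (\<Sum>j\<in>{1..<r}. \<Sum>y\<in>carrier G. if y = a \<otimes> g [^] (d * j) then \<chi> (y \<otimes> x) else 0)"
      unfolding \<delta>_def sum_distrib_right by (subst sum.swap) (intro sum.cong refl, simp)
    thus ?thesis using that finite_carrier by (simp add: S_def)
  qed
  have \<delta>_int: "\<delta> a y \<in> \<O>" for a y unfolding \<delta>_def by (intro \<O>_sum) auto
  have S_off_C: "S a x = 0"
    if ax: "a \<in> carrier G" "x \<in> carrier G" "\<And>j::nat. a \<otimes> g [^] j \<otimes> x \<notin> C" for a x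
    using ax unfolding S_def by (intro sum.neutral ballI off_C) auto
  have S_C: "S (g [^] k) (g [^] i) = V (g [^] k \<otimes> g [^] i)" for k i :: nat
    by (simp add: S_def V_def m_assoc pow_commute[of i])
  have S_t: "S (inv t \<otimes> a) (x \<otimes> t) = S a x" if "a \<in> carrier G" "x \<in> carrier G" for a x
    unfolding S_def
  proof (rule sum.cong)
    fix j
    show "\<chi> (inv t \<otimes> a \<otimes> g [^] (d * j) \<otimes> (x \<otimes> t)) = \<chi> (a \<otimes> g [^] (d * j) \<otimes> x)"
      using class_function[of "inv t" "a \<otimes> g [^] (d * j) \<otimes> x \<otimes> t"] that by (simp add: m_assoc)
  qed simp
  have inv_t: "inv t \<notin> C" using t_notin by (metis C.m_inv_closed inv_inv t)
  \<comment> \<open>For \<open>x \<in> C\<close> the terms with \<open>t\<close> vanish since \<open>\<chi>\<close> vanishes off \<open>C\<close>, and for \<open>x \<notin> C\<close> the other two terms do;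
    conjugation by \<open>t\<close> then reduces the claim to \<open>recover\<close>.\<close>
  have dual: "\<chi> (w \<otimes> x) = c * (- S g' x * \<chi> w + S \<one> x * \<chi> (w \<otimes> g)
      - S (inv t \<otimes> g') x * \<chi> (w \<otimes> t) + S (inv t) x * \<chi> (w \<otimes> (g \<otimes> t)))"
    if w: "w \<in> carrier G" and x: "x \<in> carrier G" for w x
  proof (cases "x \<in> C")
    case True
    then obtain i :: nat where i: "x = g [^] i" by (rule C_E)
    have "inv t \<otimes> g' \<otimes> g [^] j \<otimes> x \<notin> C" "inv t \<otimes> g [^] j \<otimes> x \<notin> C" for j :: nat
      by (intro notin_C inv_t; simp add: i)+
    hence "S (inv t \<otimes> g') x = 0" "S (inv t) x = 0"
      using x by (auto intro!: S_off_C)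
    moreover have "S g' x = V (g' \<otimes> g [^] i)" unfolding i g'_def by (rule S_C)
    moreover have "S \<one> x = V (g [^] i)" using S_C[of 0 i] by (simp add: i)
    ultimately show ?thesis using recover[OF w, of i] by (simp only: i) simp
  next
    case False
    then obtain i :: nat where i: "x = g [^] i \<otimes> t" using off_C_E x by blast
    have "g' \<otimes> g [^] j \<otimes> x \<notin> C" "\<one> \<otimes> g [^] j \<otimes> x \<notin> C" for j :: nat
      by (intro notin_C(1) False x; simp)+
    hence "S g' x = 0" "S \<one> x = 0"
      using x by (auto intro!: S_off_C)
    moreover have "S (inv t \<otimes> g') x = V (g' \<otimes> g [^] i)"
      unfolding i by (subst S_t) (auto simp: S_C[of "Suc d", folded g'_def])
    moreover have "S (inv t) x = V (g [^] i)"
      using S_t[of \<one> "g [^] i"] S_C[of 0 i] by (simp add: i)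
    moreover have "\<chi> (w \<otimes> x) = \<chi> (t \<otimes> w \<otimes> g [^] i)"
      using class_function[of t "w \<otimes> g [^] i"] w by (simp add: i m_assoc)
    moreover have "\<chi> (t \<otimes> w) = \<chi> (w \<otimes> t)" using w by (intro class_function) auto
    moreover have "\<chi> (t \<otimes> w \<otimes> g) = \<chi> (w \<otimes> (g \<otimes> t))"
      using class_function[of t "w \<otimes> g"] w by (simp add: m_assoc)
    ultimately show ?thesis using recover[of "t \<otimes> w" i] w by simp
  qed
  have g_nontriv: "\<not> (\<forall>w\<in>carrier G. \<chi> (w \<otimes> g) = \<chi> w)"
    using trivial_power_mult[of 1 4] nontrivial by (auto simp: trivial_power_def)
  have g_C: "g \<in> C" using pow_C[of 1] by simp
  have gt_notin: "g \<otimes> t \<notin> C" using notin_C(1)[OF g_C t t_notin] .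
  have g_ne: "g \<noteq> \<one>" using g_nontriv by auto
  have cross: False if "i \<in> C" "j \<in> carrier G" "j \<notin> C"
    "\<And>w. w \<in> carrier G \<Longrightarrow> \<chi> (w \<otimes> i) = \<chi> (w \<otimes> j)" for i j
  proof -
    have iG: "i \<in> carrier G" using that(1) by (rule C.mem_carrier)
    have "inv i \<otimes> j \<notin> C" by (rule notin_C(1)[OF C.m_inv_closed[OF that(1)] that(2,3)])
    hence "\<chi> (inv i \<otimes> j) = 0" using iG that(2) by (intro off_C) auto
    moreover have "\<chi> (inv i \<otimes> i) = \<chi> (inv i \<otimes> j)" by (rule that(4)) (use iG in simp)
    ultimately show False using iG degree_nonzero by simp
  qed
  define J where "J = {\<one>, g, t, g \<otimes> t}"
  define \<beta> where "\<beta> = (\<lambda>j y. if j = \<one> then - \<delta> g' y else if j = g then \<delta> \<one> y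
    else if j = t then - \<delta> (inv t \<otimes> g') y else \<delta> (inv t) y)"
  have t_ne: "t \<noteq> \<one>" "t \<noteq> g" using t_notin g_C by auto
  have gt_ne: "g \<otimes> t \<noteq> \<one>" "g \<otimes> t \<noteq> g" "g \<otimes> t \<noteq> t"
    using gt_notin g_C g_ne by (auto simp: r_cancel_one)
  show ?thesis
  proof (rule symmetric_if_dual_family[of J \<beta> c])
    show "J \<subseteq> carrier G" by (auto simp: J_def)
    show "\<beta> j y \<in> \<O>" for j y using \<delta>_int by (auto simp: \<beta>_def)
    show "c * \<chi> x \<in> \<O>" if "x \<in> carrier G" for x by (rule c_int[OF that])
    show "i = j" if "i \<in> J" "j \<in> J" and eq: "\<And>w. w \<in> carrier G \<Longrightarrow> \<chi> (w \<otimes> i) = \<chi> (w \<otimes> j)" for i j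
    proof -
      have G: "i \<in> carrier G" "j \<in> carrier G" using that(1,2) by (auto simp: J_def)
      have side: "i \<in> C \<longleftrightarrow> j \<in> C"
        using cross[OF _ G(2) _ eq] cross[OF _ G(1) _ eq[symmetric]] by blast
      have eq': "\<forall>w\<in>carrier G. \<chi> (w \<otimes> i) = \<chi> (w \<otimes> j)" using eq by blast
      show ?thesis
      proof (rule ccontr, cases "i \<in> C")
        assume "i \<noteq> j"
        case True
        hence "i = \<one> \<and> j = g \<or> i = g \<and> j = \<one>"
          using that(1,2) \<open>i \<noteq> j\<close> side t_notin gt_notin unfolding J_def by blast
        hence "\<forall>w\<in>carrier G. \<chi> (w \<otimes> g) = \<chi> (w \<otimes> \<one>)" using eq' by metis
        thus False using g_nontriv by simp
      next
        assume "i \<noteq> j"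
        case False
        hence "i = t \<and> j = g \<otimes> t \<or> i = g \<otimes> t \<and> j = t"
          using that(1,2) \<open>i \<noteq> j\<close> side g_C C.one_closed unfolding J_def by blast
        hence *: "\<forall>w\<in>carrier G. \<chi> (w \<otimes> (g \<otimes> t)) = \<chi> (w \<otimes> t)" using eq' by metis
        have "\<chi> (w \<otimes> g) = \<chi> w" if w: "w \<in> carrier G" for w
          using *[rule_format, of "inv t \<otimes> w"] w class_function[of "inv t" "w \<otimes> (g \<otimes> t)"]
            class_function[of "inv t" "w \<otimes> t"] by (simp add: m_assoc)
        thus False using g_nontriv by blast
      qed
    qed
    show "\<chi> (w \<otimes> x) = c * (\<Sum>j\<in>J. (\<Sum>y\<in>carrier G. \<beta> j y * \<chi> (y \<otimes> x)) * \<chi> (w \<otimes> j))"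
      if w: "w \<in> carrier G" and x: "x \<in> carrier G" for w x
    proof -
      have \<beta>_S: "(\<Sum>y\<in>carrier G. \<beta> \<one> y * \<chi> (y \<otimes> x)) = - S g' x"
        "(\<Sum>y\<in>carrier G. \<beta> g y * \<chi> (y \<otimes> x)) = S \<one> x"
        "(\<Sum>y\<in>carrier G. \<beta> t y * \<chi> (y \<otimes> x)) = - S (inv t \<otimes> g') x"
        "(\<Sum>y\<in>carrier G. \<beta> (g \<otimes> t) y * \<chi> (y \<otimes> x)) = S (inv t) x"
        using t_ne gt_ne g_ne by (simp_all add: \<beta>_def \<delta>_S sum_negf)
      have "(\<Sum>j\<in>J. (\<Sum>y\<in>carrier G. \<beta> j y * \<chi> (y \<otimes> x)) * \<chi> (w \<otimes> j))
          = - S g' x * \<chi> w + S \<one> x * \<chi> (w \<otimes> g)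
            - S (inv t \<otimes> g') x * \<chi> (w \<otimes> t) + S (inv t) x * \<chi> (w \<otimes> (g \<otimes> t))"
        unfolding J_def using t_ne gt_ne g_ne t_ne[symmetric] gt_ne[symmetric] g_ne[symmetric] w
        by (simp add: \<beta>_S)
      thus ?thesis using dual[OF w x] by simp
    qed
  qed
qed

end

section \<open>Lifting the exponent\<close>

text \<open>The binomial theorem modulo \<open>d\<^sup>2\<close>.\<close>

lemma one_plus_power_expansion: "\<exists>k::nat. (1 + d) ^ i = 1 + i * d + k * (d * d)"
proof (induction i)
  case 0
  show ?case by simp
next
  case (Suc i)
  then obtain k where "(1 + d) ^ i = 1 + i * d + k * (d * d)" by blast
  hence "(1 + d) ^ Suc i = 1 + Suc i * d + (k + i + k * d) * (d * d)"
    by (simp add: algebra_simps)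
  thus ?case by blast
qed

lemma one_plus_power_eq: "(1 + d :: nat) ^ n = 1 + d * (\<Sum>i<n. (1 + d) ^ i)"
  by (induction n) (simp_all add: algebra_simps)

text \<open>Modulo \<open>p\<^sup>2\<close> the sum is \<open>p + d p (p - 1) / 2\<close>. The second term vanishes: for \<open>p = 2\<close> it
  is \<open>d\<close>, a multiple of \<open>4\<close>.\<close>

lemma geometric_sum_eq_prime_times:
  fixes p d :: nat
  assumes "prime p" "p dvd d" "p = 2 \<Longrightarrow> 4 dvd d"
  shows "\<exists>x. (\<Sum>i<p. (1 + d) ^ i) = p * (1 + p * x)"
proof (cases "p = 2")
  case True
  then obtain e where "d = 4 * e" using assms(3) by blast
  thus ?thesis using True by (intro exI[of _ e]) (simp add: numeral_2_eq_2)
next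
  case False
  hence "odd p" using assms(1) primes_dvd_imp_eq two_is_prime_nat by blast
  then obtain q where q: "p = 2 * q + 1" by (rule oddE)
  obtain e where e: "d = p * e" using assms(2) by blast
  obtain k where k: "\<And>i. (1 + d) ^ i = 1 + i * d + k i * (d * d)"
    using one_plus_power_expansion by metis
  have "(\<Sum>i<p. i) = p * q"
  proof -
    have "(\<Sum>i<Suc m. i) * 2 = m * Suc m" for m :: nat by (induction m) simp_all
    from this[of "2 * q"] show ?thesis by (simp add: q)
  qed
  hence "(\<Sum>i<p. (1 + d) ^ i) = p + p * q * d + (\<Sum>i<p. k i) * (d * d)"
    by (simp only: k sum.distrib sum_distrib_right[symmetric]) simp
  also have "\<dots> = p * (1 + p * (q * e + (\<Sum>i<p. k i) * (e * e)))"
    by (simp add: e algebra_simps)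
  finally show ?thesis by blast
qed

text \<open>Fermat's little theorem gives \<open>p dvd d\<close>. As \<open>(1 + d) ^ p - 1\<close> is \<open>d\<close> times a geometric sum in which \<open>p\<close> occurs
  exactly once, \<open>p ^ N\<close> divides \<open>d * p\<close>. For \<open>p = 2\<close> and odd \<open>d\<close> only \<open>N = 0\<close> is possible.\<close>

lemma prime_power_dvd_square:
  fixes p d N :: nat
  assumes p: "prime p" and dvd: "p ^ N dvd (1 + d) ^ p - 1" and two: "p = 2 \<Longrightarrow> 4 dvd d \<or> odd d"
  shows "p ^ N dvd d * d"
proof (cases "N = 0")
  case False
  have dvd': "p ^ N dvd d * (\<Sum>i<p. (1 + d) ^ i)"
    using dvd by (subst (asm) one_plus_power_eq) simp
  have "p dvd d"
  proof -
    have "p dvd (1 + d) ^ p - 1" using dvd False by (meson dvd_power dvd_trans gr0I)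
    then obtain k where "(1 + d) ^ p - 1 = p * k" by (rule dvdE)
    moreover have "(1 + d) ^ p = 1 + ((1 + d) ^ p - 1)" by simp
    ultimately have "(1 + d) ^ p = 1 + p * k" by (simp only:)
    hence "[(1 + d) ^ p = 1] (mod p)" by (simp only: cong_def mod_mult_self2)
    moreover have "[(1 + d) ^ p = 1 + d] (mod p)"
    proof (cases "p dvd 1 + d")
      case True
      hence "p dvd (1 + d) ^ p" using prime_gt_0_nat[OF p] by (meson dvd_power dvd_trans)
      thus ?thesis using True by (metis cong_0_iff cong_sym cong_trans)
    next
      case False
      have "[(1 + d) ^ (p - 1) * (1 + d) = 1 * (1 + d)] (mod p)"
        by (intro cong_mult fermat_theorem p False cong_refl)
      moreover have "(1 + d) ^ (p - 1) * (1 + d) = (1 + d) ^ p"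
        using prime_gt_0_nat[OF p] by (metis Suc_pred' power_Suc2)
      ultimately show ?thesis by simp
    qed
    ultimately have "[1 + d = 1 + 0] (mod p)" by (metis add.right_neutral cong_sym cong_trans)
    hence "[d = 0] (mod p)" using cong_add_lcancel_nat by blast
    thus ?thesis by (simp add: cong_0_iff)
  qed
  moreover from this have "4 dvd d" if "p = 2" using two[OF that] that by blast
  ultimately obtain x where sum_eq: "(\<Sum>i<p. (1 + d) ^ i) = p * (1 + p * x)"
    using geometric_sum_eq_prime_times[OF p] by blast
  have "p ^ N dvd (d * p) * (1 + p * x)" using dvd' unfolding sum_eq by (simp only: mult.assoc)
  moreover have "coprime (p ^ N) (1 + p * x)"
  proof -
    have "coprime (p * x) (p * x + 1)" by (rule coprime_add_one_right)
    hence "coprime p (1 + p * x)" unfolding add.commute[of 1] using coprime_mult_left_iff by blast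
    thus ?thesis by (metis coprime_power_left_iff)
  qed
  ultimately have "p ^ N dvd d * p" using coprime_dvd_mult_left_iff by blast
  thus ?thesis using \<open>p dvd d\<close> by (meson dvd_trans dvd_refl mult_dvd_mono)
qed simp

section \<open>Cyclic normal subgroups of prime index\<close>

text \<open>The indices of \<open>C\<close> in \<open>H\<close> and of \<open>H\<close> in \<open>G\<close> multiply to a prime.\<close>

lemma (in group) subgroup_above_prime_index:
  assumes fin: "finite (carrier G)" and C: "subgroup C G" and p: "prime (card (rcosets C))"
    and H: "subgroup H G" and CH: "C \<subseteq> H" and t: "t \<in> H" "t \<notin> C"
  shows "H = carrier G"
proof -
  have sub: "H \<subseteq> carrier G" "C \<subseteq> carrier G" using H C by (simp_all add: subgroup.subset)
  have finH: "finite H" using sub fin finite_subset by blast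
  define k where "k = card (rcosets\<^bsub>G\<lparr>carrier := H\<rparr>\<^esub> C)"
  have k: "card H = k * card C"
    using group.lagrange[OF subgroup.subgroup_is_group[OF H is_group] subgroup_incl[OF C H CH]]
    by (simp add: Coset.order_def k_def)
  define l where "l = card (rcosets H)"
  have l: "l * card H = card (carrier G)"
    using lagrange[OF H] by (simp add: Coset.order_def l_def)
  have "card C > 0" using finite_subset[OF CH finH] subgroup.one_closed[OF C] card_gt_0_iff by blast
  moreover have "card (rcosets C) * card C = (l * k) * card C"
    using lagrange[OF C] k l by (simp add: Coset.order_def)
  ultimately have "card (rcosets C) = l * k" by simp
  hence "k = 1 \<or> l = 1" using p prime_product by metis
  thus ?thesis
  proof
    assume "k = 1"
    hence "C = H" using k CH finH by (simp add: card_subset_eq)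
    thus ?thesis using t by simp
  next
    assume "l = 1"
    thus ?thesis using l sub fin by (simp add: card_subset_eq)
  qed
qed

lemma (in group) cyclic_subgroup_eq_nat_powers:
  assumes fin: "finite (carrier G)" and C: "subgroup C G" and cyc: "cyclic_group (G\<lparr>carrier := C\<rparr>)"
  shows "\<exists>g\<in>C. C = range (\<lambda>i::nat. g [^] i) \<and> ord g = card C"
proof -
  have "group (G\<lparr>carrier := C\<rparr>)" using C by (rule subgroup_imp_group)
  then obtain g where g: "g \<in> C" and eq: "C = range (\<lambda>i::int. g [^]\<^bsub>G\<lparr>carrier := C\<rparr>\<^esub> i)"
    using cyc by (auto simp: group.cyclic_group)
  have gG: "g \<in> carrier G" using g C subgroup.subset by blast
  have "C = range (\<lambda>i::int. g [^] i)"
    using eq by (simp only: int_pow_consistent[OF C g, symmetric])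
  hence gen: "C = generate G {g}" using generate_pow[OF gG] by auto
  have "ord g \<noteq> 0" using ord_ge_1[OF fin gG] by simp
  hence "C = range (\<lambda>i::nat. g [^] i)" using gen generate_pow_nat[OF gG] by auto
  moreover have "ord g = card C" using generate_pow_card[OF gG] gen by simp
  ultimately show ?thesis using g by blast
qed

lemma (in group) pow_index_mem_normal:
  assumes C: "C \<lhd> G" and t: "t \<in> carrier G"
  shows "t [^] card (rcosets C) \<in> C"
proof -
  interpret C: normal C G by (rule C)
  interpret Q: group "G Mod C" by (rule C.factorgroup_is_group)
  have "(C #> t) [^]\<^bsub>G Mod C\<^esub> card (rcosets C) = \<one>\<^bsub>G Mod C\<^esub>"
    using Q.pow_order_eq_1[of "C #> t"] t by (simp add: Coset.order_def FactGroup_def RCOSETS_def) blast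
  moreover have "(C #> t) [^]\<^bsub>G Mod C\<^esub> (n::nat) = C #> (t [^] n)" for n
    using hom_nat_pow[OF C.r_coset_hom_Mod t is_group Q.is_group] by simp
  ultimately have "C #> (t [^] card (rcosets C)) = C" by simp
  thus ?thesis using coset_join1[OF _ _ C.is_subgroup] t by simp
qed

theorem proposition1p6:
  fixes p :: nat
    and \<O> :: "'a::field_char_0 set"
    and \<pi> :: "'a \<Rightarrow> 'k::field"
    and P :: "('g, 'm) monoid_scheme"
    and C :: "'g set"
    and \<chi> :: "'g \<Rightarrow> 'a"
  assumes "prime p"
    and "complete_dvr \<O>"
    and "residue_map \<O> \<pi>"
    and "CHAR('k) = p"
    and "group P"
    and "\<exists>n. Coset.order P = p ^ n"
    and "C \<lhd> P"
    and "cyclic_group (P\<lparr>carrier := C\<rparr>)"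
    and "card (rcosets\<^bsub>P\<^esub> C) = p"
    and "splitting_field TYPE('a) P" and "splitting_field TYPE('a) (P\<lparr>carrier := C\<rparr>)"
    and "splitting_field TYPE('k) P" and "splitting_field TYPE('k) (P\<lparr>carrier := C\<rparr>)"
    and "\<chi> \<in> Irr P"
  shows "symmetric_algebra (coeff_ring \<O>) (char_component \<O> P \<chi>)"
proof -
  interpret group P by fact
  interpret C: normal C P by fact
  obtain n where n: "Coset.order P = p ^ n" using assms(6) by blast
  have fin: "finite (carrier P)"
    using n prime_gt_0_nat[OF \<open>prime p\<close>] by (simp flip: order_gt_0_iff_finite)
  have C: "subgroup C P" by (rule C.subgroup_axioms)
  obtain g where gC: "g \<in> C" and C_eq: "C = range (\<lambda>i::nat. g [^]\<^bsub>P\<^esub> i)" and ord_g: "ord g = card C"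
    using cyclic_subgroup_eq_nat_powers[OF fin C assms(8)] by blast
  have g: "g \<in> carrier P" using gC by (rule C.mem_carrier)
  have index: "p * card C = p ^ n" using lagrange[OF C] assms(9) n by simp
  obtain N where N: "card C = p ^ N"
    using divides_primepow_nat[OF \<open>prime p\<close>, of "card C" n] index by (metis dvd_triv_right)
  have "C \<noteq> carrier P"
  proof
    assume "C = carrier P"
    hence "p * p ^ n = p ^ n" using index n by (simp add: Coset.order_def)
    thus False using \<open>prime p\<close> by (simp add: prime_nat_iff)
  qed
  then obtain t where tP: "t \<in> carrier P" and tC: "t \<notin> C" using C.subset by blast
  have "t \<otimes>\<^bsub>P\<^esub> g \<otimes>\<^bsub>P\<^esub> inv\<^bsub>P\<^esub> t \<in> C" using tP gC by (rule C.inv_op_closed2)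
  then obtain a :: nat where a: "t \<otimes>\<^bsub>P\<^esub> g \<otimes>\<^bsub>P\<^esub> inv\<^bsub>P\<^esub> t = g [^]\<^bsub>P\<^esub> a" using C_eq by auto
  \<comment> \<open>Adding the order of \<open>g\<close> keeps the exponent positive, so it can be written as \<open>Suc d\<close>.\<close>
  define d where "d = a + ord g - 1"
  have Suc_d: "Suc d = a + ord g" using ord_ge_1[OF fin g] by (simp add: d_def)
  have conj: "t \<otimes>\<^bsub>P\<^esub> g \<otimes>\<^bsub>P\<^esub> inv\<^bsub>P\<^esub> t = g [^]\<^bsub>P\<^esub> Suc d"
    unfolding Suc_d a using g by (simp flip: nat_pow_mult)
  obtain v where v: "discrete_valuation v" "\<O> = valuation_ring v"
    using assms(2) unfolding complete_dvr_def by blast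
  interpret irreducible_character P \<chi>
    by (rule irreducible_character_Irr[OF fin assms(10,14)])
  have generate: "H = carrier P" if "subgroup H P" "g \<in> H" "t \<in> H" for H
  proof (rule subgroup_above_prime_index[OF fin C _ that(1) _ that(3) tC])
    show "prime (card (rcosets\<^bsub>P\<^esub> C))" using assms(1,9) by simp
    have "g [^]\<^bsub>P\<^esub> (i::nat) \<in> H" for i
      by (induction i) (use that in \<open>auto intro: subgroup.one_closed subgroup.m_closed\<close>)
    thus "C \<subseteq> H" using C_eq by auto
  qed
  interpret cyclic_extension_character P \<chi> \<O> v g t d
    by unfold_locales (fact v g tP generate conj)+
  have conj_iter: "t [^]\<^bsub>P\<^esub> k \<otimes>\<^bsub>P\<^esub> g \<otimes>\<^bsub>P\<^esub> inv\<^bsub>P\<^esub> (t [^]\<^bsub>P\<^esub> k) = g [^]\<^bsub>P\<^esub> ((1 + d) ^ k)" for k :: nat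
  proof (induction k)
    case (Suc k)
    have "t [^]\<^bsub>P\<^esub> Suc k \<otimes>\<^bsub>P\<^esub> g \<otimes>\<^bsub>P\<^esub> inv\<^bsub>P\<^esub> (t [^]\<^bsub>P\<^esub> Suc k)
        = t \<otimes>\<^bsub>P\<^esub> (t [^]\<^bsub>P\<^esub> k \<otimes>\<^bsub>P\<^esub> g \<otimes>\<^bsub>P\<^esub> inv\<^bsub>P\<^esub> (t [^]\<^bsub>P\<^esub> k)) \<otimes>\<^bsub>P\<^esub> inv\<^bsub>P\<^esub> t"
      unfolding nat_pow_Suc2[OF tP] using tP g by (simp add: m_assoc inv_mult_group)
    also have "\<dots> = g [^]\<^bsub>P\<^esub> ((1 + d) ^ Suc k)" unfolding Suc conj_pow by simp
    finally show ?case .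
  qed (use g in simp)
  have "p ^ N dvd (1 + d) ^ p - 1"
  proof -
    have "t [^]\<^bsub>P\<^esub> p \<in> C" using pow_index_mem_normal[OF assms(7) tP] assms(9) by simp
    then obtain i :: nat where i: "t [^]\<^bsub>P\<^esub> p = g [^]\<^bsub>P\<^esub> i" using C_eq by auto
    have "g [^]\<^bsub>P\<^esub> ((1 + d) ^ p) = g [^]\<^bsub>P\<^esub> i \<otimes>\<^bsub>P\<^esub> g \<otimes>\<^bsub>P\<^esub> inv\<^bsub>P\<^esub> (g [^]\<^bsub>P\<^esub> i)"
      using conj_iter[of p] by (simp only: i)
    also have "g [^]\<^bsub>P\<^esub> i \<otimes>\<^bsub>P\<^esub> g = g \<otimes>\<^bsub>P\<^esub> g [^]\<^bsub>P\<^esub> i"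
      using nat_pow_Suc2[OF g, of i] by simp
    also have "\<dots> \<otimes>\<^bsub>P\<^esub> inv\<^bsub>P\<^esub> (g [^]\<^bsub>P\<^esub> i) = g" using g by (simp add: m_assoc)
    also have "(1 + d) ^ p = Suc ((1 + d) ^ p - 1)" by simp
    finally have "g [^]\<^bsub>P\<^esub> ((1 + d) ^ p - 1) \<otimes>\<^bsub>P\<^esub> g = \<one>\<^bsub>P\<^esub> \<otimes>\<^bsub>P\<^esub> g"
      using g by (simp only: nat_pow_Suc l_one)
    hence "g [^]\<^bsub>P\<^esub> ((1 + d) ^ p - 1) = \<one>\<^bsub>P\<^esub>" using g right_cancel by simp
    thus ?thesis using pow_eq_id[OF g] ord_g N by simp
  qed
  hence square: "p ^ N dvd d * d" if "p = 2 \<Longrightarrow> 4 dvd d \<or> odd d"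
    using prime_power_dvd_square[OF \<open>prime p\<close>] that by blast
  have g_pow_N: "g [^]\<^bsub>P\<^esub> (p ^ N) = \<one>\<^bsub>P\<^esub>" using pow_eq_id[OF g] ord_g N by simp
  show ?thesis
  proof (cases "p = 2 \<and> \<not> (4 dvd d \<or> odd d)")
    case False
    hence "p ^ N dvd d * d" using square by blast
    hence "g [^]\<^bsub>P\<^esub> (d * d) = \<one>\<^bsub>P\<^esub>" using pow_eq_id[OF g] ord_g N by simp
    hence "trivial_power (d * d)" by (simp add: trivial_power_def)
    thus ?thesis by (rule symmetric_if_trivial_power)
  next
    case True
    then obtain b where b: "d = 2 * b" "odd b" by (auto elim!: evenE)
    show ?thesis
    proof (cases "trivial_power 4")
      case True
      hence "trivial_power (4 * (b * b))" by (rule trivial_power_mult)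
      hence "trivial_power (d * d)" by (simp add: b mult_ac)
      thus ?thesis by (rule symmetric_if_trivial_power)
    next
      case nontrivial: False
      \<comment> \<open>Otherwise \<open>C\<close> and the cosets of \<open>t\<close> and \<open>x\<close> would be three cosets.\<close>
      have cover: "x \<otimes>\<^bsub>P\<^esub> inv\<^bsub>P\<^esub> t \<in> C" if x: "x \<in> carrier P" "x \<notin> C" for x
      proof (rule ccontr)
        assume xt: "x \<otimes>\<^bsub>P\<^esub> inv\<^bsub>P\<^esub> t \<notin> C"
        have "card {C, C #>\<^bsub>P\<^esub> t, C #>\<^bsub>P\<^esub> x} \<le> card (rcosets\<^bsub>P\<^esub> C)"
        proof (rule card_mono)
          show "finite (rcosets\<^bsub>P\<^esub> C)" using assms(9) True by (intro card_ge_0_finite) simp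
          show "{C, C #>\<^bsub>P\<^esub> t, C #>\<^bsub>P\<^esub> x} \<subseteq> rcosets\<^bsub>P\<^esub> C"
            using x tP C.subgroup_in_rcosets[OF is_group] by (auto simp: rcosetsI C.subset)
        qed
        moreover have "C #>\<^bsub>P\<^esub> t \<noteq> C" "C #>\<^bsub>P\<^esub> x \<noteq> C" 
          using coset_join1[OF _ tP C] coset_join1[OF _ x(1) C] tC x(2) by blast+
        moreover have "C #>\<^bsub>P\<^esub> t \<noteq> C #>\<^bsub>P\<^esub> x"
        proof
          assume eq: "C #>\<^bsub>P\<^esub> t = C #>\<^bsub>P\<^esub> x"
          have "x \<in> C #>\<^bsub>P\<^esub> t" unfolding eq by (rule rcos_self[OF x(1) C])
          then obtain c where c: "c \<in> C" "x = c \<otimes>\<^bsub>P\<^esub> t" unfolding r_coset_def by blast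
          have "c \<in> carrier P" using c(1) by (rule C.mem_carrier)
          hence "x \<otimes>\<^bsub>P\<^esub> inv\<^bsub>P\<^esub> t = c" unfolding c(2) using tP by (simp add: m_assoc)
          thus False using xt c(1) by blast
        qed
        ultimately show False using assms(9) True by auto
      qed
      have "index_two_character P \<chi> \<O> v g t d C b N"
        by unfold_locales (use C_eq tC cover b g_pow_N nontrivial True in auto)
      thus ?thesis by (rule index_two_character.symmetric_index_two)
    qed
  qed
qed

end
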